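(* For all integers $n,k\ge 1$, the number $p(\delta_{n+2k}/\delta_n)$ of pleasant diagrams of the skew shape $\delta_{n+2k}/\delta_n$ satisfies \[ p(\delta_{n+2k}/\delta_n) = 2^{\binom k2}\det\left(\mathfrak{s}_{n-2+i+j}\right)_{i,j=1}^k , \] where $\mathfrak{s}_m = 2^{m+2}s_m$ and $s_m$ is the $m$-th little Schröder number ($m\ge 1$).
   Context: Partitions are identified with their Young diagrams: $(i,j)\in\lambda$ means that the diagram of $\lambda$ has a square in row $i$ (from the top) and column $j$ (from the left). For $n\ge1$, $\delta_n=(n-1,n-2,\dots,1)$ is the staircase partition ($\delta_1=\emptyset$). For $\mu\subset\lambda$ (containment of Young diagrams) the skew shape $\lambda/\mu$ is the set difference of the diagrams. Excited diagrams: let $D$ be a set of squares of $\lambda$. If $(i,j)\in D$, $(i+1,j),(i,j+1),(i+1,j+1)\notin D$ and $(i+1,j+1)\in\lambda$, then replacing $(i,j)$ by $(i+1,j+1)$ in $D$ is an excited move. An excited diagram of $\lambda/\mu$ is a set of squares obtained from $\mu$ by a (possibly empty) sequence of excited moves inside $\lambda$. Pleasant diagrams: a pleasant diagram of $\lambda/\mu$ is a subset of $\lambda\setminus D$ for some excited diagram $D$ of $\lambda/\mu$. $p(\lambda/\mu)$ is the number of pleasant diagrams of $\lambda/\mu$. Little Schröder numbers: $s_m$ is the number of lattice paths from $(-m,0)$ to $(m,0)$ that never go below the $x$-axis, using up steps $(1,1)$, down steps $(1,-1)$ and horizontal steps $(2,0)$, with no horizontal step on the $x$-axis. Thus $s_1=1$,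 $s_2=3$, $s_3=11$. *)

theory Defs
  imports Main "Jordan_Normal_Form.Determinant"
begin

section \<open>Partitions and Young diagrams\<close>

text \<open>A partition is the list of its parts; rows and columns of its diagram are numbered from 1.\<close>

type_synonym square = "nat \<times> nat"

definition diagram :: "nat list \<Rightarrow> square set" where
  "diagram \<nu> = {(i, j). 1 \<le> i \<and> i \<le> length \<nu> \<and> 1 \<le> j \<and> j \<le> \<nu> ! (i - 1)}"

definition staircase :: "nat \<Rightarrow> nat list" where
  "staircase n = rev [1..<n]"

section \<open>Excited and pleasant diagrams\<close>

inductive excited_move :: "square set \<Rightarrow> square set \<Rightarrow> square set \<Rightarrow> bool"
  for \<Lambda> :: "square set" where
  "\<lbrakk>(i, j) \<in> D; (i + 1, j) \<notin> D; (i, j + 1) \<notin> D; (i + 1, j + 1) \<notin> D; (i + 1, j + 1) \<in> \<Lambda>\<rbrakk>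
    \<Longrightarrow> excited_move \<Lambda> D (insert (i + 1, j + 1) (D - {(i, j)}))"

definition excited_diagrams :: "nat list \<Rightarrow> nat list \<Rightarrow> square set set" where
  "excited_diagrams \<nu> \<mu> = {D. (excited_move (diagram \<nu>))\<^sup>*\<^sup>* (diagram \<mu>) D}"

definition pleasant_diagrams :: "nat list \<Rightarrow> nat list \<Rightarrow> square set set" where
  "pleasant_diagrams \<nu> \<mu> = {P. \<exists>D \<in> excited_diagrams \<nu> \<mu>. P \<subseteq> diagram \<nu> - D}"

definition num_pleasant :: "nat list \<Rightarrow> nat list \<Rightarrow> nat" where
  "num_pleasant \<nu> \<mu> = card (pleasant_diagrams \<nu> \<mu>)"

section \<open>Little Schroeder numbers\<close>

datatype step = Up | Down | Horizontal

fun step_vec :: "step \<Rightarrow> int \<times> int" where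
  "step_vec Up = (1, 1)"
| "step_vec Down = (1, -1)"
| "step_vec Horizontal = (2, 0)"

fun walk :: "int \<times> int \<Rightarrow> step list \<Rightarrow> int \<times> int" where
  "walk (x, y) [] = (x, y)"
| "walk (x, y) (s # ss) = walk (x + fst (step_vec s), y + snd (step_vec s)) ss"

text \<open>A lattice path is encoded by its sequence of steps, which together with the starting
  point \<open>(-m, 0)\<close> determines it; \<open>walk (- int m, 0) (take t w)\<close> is the point reached
  after \<open>t\<close> steps.\<close>

definition little_schroeder_paths :: "nat \<Rightarrow> step list set" where
  "little_schroeder_paths m =
    {w. walk (- int m, 0) w = (int m, 0)
      \<and> (\<forall>t \<le> length w. 0 \<le> snd (walk (- int m, 0) (take t w)))
      \<and> (\<forall>t < length w. w ! t = Horizontal \<longrightarrow> snd (walk (- int m, 0) (take t w)) \<noteq> 0)}"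

definition little_schroeder :: "nat \<Rightarrow> nat" where
  "little_schroeder m = card (little_schroeder_paths m)"

definition scaled_schroeder :: "nat \<Rightarrow> nat" where
  "scaled_schroeder m = 2 ^ (m + 2) * little_schroeder m"

text \<open>Matrices of the library are indexed from 0, so the entry at \<open>(i, j)\<close> here is the one at
  \<open>(i + 1, j + 1)\<close> in the usual 1-based numbering. The subtraction of 2 comes last, so it
  never truncates.\<close>

definition schroeder_matrix :: "nat \<Rightarrow> nat \<Rightarrow> int mat" where
  "schroeder_matrix n k =
    mat k k (\<lambda>(i, j). int (scaled_schroeder (n + (i + 1) + (j + 1) - 2)))"

end

theory Submission
  imports Defs "HOL-Computational_Algebra.Formal_Power_Series"
begin

text \<open>
  An excited diagram of \<open>\<delta>\<^sub>n\<close> inside \<open>\<delta>\<^sub>n\<^sub>+\<^sub>2\<^sub>k\<close> is determined by how far each square of \<open>\<delta>\<^sub>n\<close>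
  has slid along its diagonal. The possible displacements \<open>m\<close> are the fillings of \<open>\<delta>\<^sub>n\<close> with
  numbers at most \<open>k\<close> that increase weakly along rows and columns
  (\<open>excited_diagrams_staircase\<close>). Among the displacements that move \<open>\<delta>\<^sub>n\<close> off a pleasant
  diagram \<open>P\<close> there is a least one, and the sets \<open>P\<close> for which this is \<open>m\<close> are those with a
  prescribed trace on certain squares that \<open>m\<close> passes or reaches. This gives
  \<open>p = 2 ^ \<bar>\<lambda>/\<mu>\<bar> * (\<Sum>m. (1/2) ^ excess m)\<close>, where \<open>excess m\<close> sums, over the squares of \<open>\<delta>\<^sub>n\<close>,
  the amount by which an entry of \<open>m\<close> exceeds the larger of its upper and left neighbours
  (\<open>num_pleasant_staircase\<close>).

  These excesses form an arbitrary filling \<open>a\<close> of \<open>\<delta>\<^sub>n\<close> by natural numbers, and \<open>m\<close> is the array of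
  its last passage times: the largest sums of \<open>a\<close> along lattice paths from the corner. So the sum
  is that of \<open>(1/2) ^ (sum of a)\<close> over the fillings with all last passage times at most \<open>k\<close>. The
  Robinson-Schensted-Knuth correspondence, in the form of Fomin's growth diagrams, replaces last
  passage times by first parts of partitions. Its local rule (\<open>local_growth_rule\<close>), applied to one
  antidiagonal after another (\<open>displacements_families\<close>), turns the sum into one over sequences
  \<open>\<emptyset> = \<lambda>\<^sub>0, \<kappa>\<^sub>0, \<lambda>\<^sub>1, \<kappa>\<^sub>1, \<dots>, \<lambda>\<^sub>n = \<emptyset>\<close> of partitions with parts at most \<open>k\<close>, in which horizontal strips
  are alternately removed and added.

  The columns of a partition with parts at most \<open>k\<close> correspond to a set of \<open>k\<close> distinct positions,
  and a horizontal strip moves each position by at most one. The sequences are thus families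
  of \<open>k\<close> non-intersecting Dyck paths in which peaks no longer carry weights, only steps do. Such
  families are counted by a determinant: expanding a determinant whose rows are sums of two terms
  produces one choice per path, and the choices that make two paths collide give equal rows
  (\<open>minor_hop\<close>). The result is the \<open>k \<times> k\<close> corner of the \<open>n\<close>-th power of a tridiagonal operator
  \<open>hop\<close> (\<open>displacements_determinant\<close>).

  Triangular factors turn this corner into the Hankel matrix of the moments of \<open>hop\<close>
  (\<open>hankel_determinant\<close>). Finally, both these moments and the little Schroeder numbers are
  coefficients of power series \<open>1 + X * M\<close>, where \<open>M\<close> counts Motzkin paths with constant weights.
  The weights in the two cases differ by a rescaling, which is the source of the powers of two
  (\<open>scaled_schroeder_moment\<close>).
\<close>

section \<open>Excited diagrams as displacements\<close>

definition triangle :: "nat \<Rightarrow> square set" where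
  "triangle n = {(i, j). 1 \<le> i \<and> 1 \<le> j \<and> i + j \<le> n}"

lemma diagram_staircase: "diagram (staircase n) = triangle n"
proof -
  have "(i, j) \<in> diagram (staircase n) \<longleftrightarrow> (i, j) \<in> triangle n" for i j
    by (cases "1 \<le> i \<and> i \<le> n - 1")
      (auto simp: diagram_def staircase_def triangle_def rev_nth)
  then show ?thesis by auto
qed

lemma finite_triangle [simp]: "finite (triangle n)"
  by (rule finite_subset[of _ "{..n} \<times> {..n}"]) (auto simp: triangle_def)

definition barrier :: "(nat \<Rightarrow> nat \<Rightarrow> nat) \<Rightarrow> nat \<Rightarrow> nat \<Rightarrow> nat" where
  "barrier m i j = max (m (i - 1) j) (m i (j - 1))"

text \<open>
  Fillings are functions on all of \<open>nat \<times> nat\<close> that vanish off the triangle. The zeros in row and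
  column \<open>0\<close> make the condition \<open>barrier m i j \<le> m i j\<close> express exactly the weak increase along rows
  and columns.
\<close>

definition displacements :: "nat \<Rightarrow> nat \<Rightarrow> (nat \<Rightarrow> nat \<Rightarrow> nat) set" where
  "displacements n k = {m. (\<forall>i j. (i, j) \<notin> triangle n \<longrightarrow> m i j = 0)
     \<and> (\<forall>i j. (i, j) \<in> triangle n \<longrightarrow> barrier m i j \<le> m i j \<and> m i j \<le> k)}"

definition displaced :: "nat \<Rightarrow> (nat \<Rightarrow> nat \<Rightarrow> nat) \<Rightarrow> square set" where
  "displaced n m = (\<lambda>(i, j). (i + m i j, j + m i j)) ` triangle n"

definition update :: "(nat \<Rightarrow> nat \<Rightarrow> nat) \<Rightarrow> nat \<Rightarrow> nat \<Rightarrow> nat \<Rightarrow> nat \<Rightarrow> nat \<Rightarrow> nat" where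
  "update m i j x = m(i := (m i)(j := x))"

lemma update_apply: "update m i j x i' j' = (if i' = i \<and> j' = j then x else m i' j')"
  by (simp add: update_def)

lemma displacements_mono:
  assumes m: "m \<in> displacements n k" and t: "(i', j') \<in> triangle n"
    and le: "i \<le> i'" "j \<le> j'"
  shows "m i j \<le> m i' j'"
proof -
  have row: "(i', j) \<in> triangle n \<Longrightarrow> m i j \<le> m i' j"
    using le(1)
  proof (induction i' rule: dec_induct)
    case (step q)
    have "m q j \<le> m (Suc q) j"
      using m step.prems by (force simp: displacements_def barrier_def)
    moreover have "m i j \<le> m q j"
    proof (cases "(q, j) \<in> triangle n")
      case False
      then have "q = 0" using step.prems by (auto simp: triangle_def)
      then show ?thesis using step.hyps by simp
    qed (use step in simp)
    ultimately show ?case by simp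
  qed simp
  have col: "(i', j') \<in> triangle n \<Longrightarrow> m i' j \<le> m i' j'"
    using le(2)
  proof (induction j' rule: dec_induct)
    case (step q)
    have "m i' q \<le> m i' (Suc q)"
      using m step.prems by (force simp: displacements_def barrier_def)
    moreover have "m i' j \<le> m i' q"
    proof (cases "(i', q) \<in> triangle n")
      case False
      then have "q = 0" using step.prems by (auto simp: triangle_def)
      then show ?thesis using step.hyps by simp
    qed (use step in simp)
    ultimately show ?case by simp
  qed simp
  show ?thesis
  proof (cases "(i', j) \<in> triangle n")
    case True
    then show ?thesis using row col[OF t] by linarith
  next
    case False
    then have "j = 0" using t le by (auto simp: triangle_def)
    then have "m i j = 0" using m by (auto simp: displacements_def triangle_def)
    then show ?thesis by simp
  qed
qed

text \<open>
  On its way along the diagonal a square first reaches its barrier and then its final place. The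
  square \<open>(i + d, j + d)\<close> has a barrier at least \<open>m i j\<close>, hence starts this last stretch beyond the
  final place of \<open>(i, j)\<close>. This makes sliding injective and keeps the forced squares of
  \<open>card_tight\<close> from being counted twice.
\<close>

lemma diagonal_ranges_disjoint:
  assumes m: "m \<in> displacements n k"
    and t: "(i, j) \<in> triangle n" "(i', j') \<in> triangle n"
    and s: "barrier m i j \<le> s" "s \<le> m i j" and s': "barrier m i' j' \<le> s'" "s' \<le> m i' j'"
    and eq: "i + s = i' + s'" "j + s = j' + s'"
  shows "i = i' \<and> j = j' \<and> s = s'"
proof -
  have *: "\<not> a < a'" if t: "(a, b) \<in> triangle n" "(a', b') \<in> triangle n"
    and s: "s \<le> m a b" and s': "barrier m a' b' \<le> s'"
    and eq: "a + s = a' + s'" "b + s = b' + s'" for a b a' b' s s'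
  proof
    assume lt: "a < a'"
    then have "b < b'" "s' < s" using eq by linarith+
    moreover have "(a' - 1, b') \<in> triangle n" using t lt by (auto simp: triangle_def)
    ultimately have "m a b \<le> m (a' - 1) b'" using displacements_mono[OF m] lt by simp
    also have "\<dots> \<le> s'" using s' by (simp add: barrier_def)
    finally show False using s \<open>s' < s\<close> by simp
  qed
  show ?thesis using *[OF t s(2) s'(1) eq] *[OF t(2,1) s'(2) s(1) eq[symmetric]] eq by linarith
qed

lemma inj_on_displace:
  assumes "m \<in> displacements n k"
  shows "inj_on (\<lambda>(i, j). (i + m i j, j + m i j)) (triangle n)"
proof (rule inj_onI)
  fix c c' assume "c \<in> triangle n" "c' \<in> triangle n"
    "(case c of (i, j) \<Rightarrow> (i + m i j, j + m i j)) = (case c' of (i, j) \<Rightarrow> (i + m i j, j + m i j))"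
  moreover have "barrier m i j \<le> m i j" if "(i, j) \<in> triangle n" for i j
    using assms that by (auto simp: displacements_def)
  ultimately show "c = c'"
    using diagonal_ranges_disjoint[OF assms, of "fst c" "snd c" "fst c'" "snd c'"
        "m (fst c) (snd c)" "m (fst c') (snd c')"]
    by (auto split: prod.splits)
qed

lemma update_in_displacements:
  assumes m: "m \<in> displacements n k" and t: "(i, j) \<in> triangle n"
    and x: "barrier m i j \<le> x" "x \<le> k"
    and succ: "(i + 1, j) \<in> triangle n \<Longrightarrow> x \<le> m (i + 1) j"
      "(i, j + 1) \<in> triangle n \<Longrightarrow> x \<le> m i (j + 1)"
  shows "update m i j x \<in> displacements n k"
proof -
  have pos: "0 < i" "0 < j" using t by (auto simp: triangle_def)
  have "barrier (update m i j x) a b \<le> update m i j x a b"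
    if tt: "(a, b) \<in> triangle n" for a b
  proof -
    have pos': "0 < a" "0 < b" using tt by (auto simp: triangle_def)
    have old: "m (a - 1) b \<le> m a b" "m a (b - 1) \<le> m a b"
      using m tt by (auto simp: displacements_def barrier_def)
    consider "a = i" "b = j" | "a = i + 1" "b = j" | "a = i" "b = j + 1"
      | "\<not> (a = i \<and> b = j)" "\<not> (a - 1 = i \<and> b = j)" "\<not> (a = i \<and> b - 1 = j)"
      using pos' by linarith
    then show ?thesis
    proof cases
      case 1
      then show ?thesis using x pos by (auto simp: barrier_def update_apply)
    next
      case 2
      then show ?thesis using tt succ old by (auto simp: barrier_def update_apply)
    next
      case 3
      then show ?thesis using tt succ old by (auto simp: barrier_def update_apply)
    next
      case 4
      then show ?thesis using old by (auto simp: barrier_def update_apply)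
    qed
  qed
  then show ?thesis using m t x by (auto simp: displacements_def update_apply)
qed

lemma displaced_update:
  assumes m: "m \<in> displacements n k" and t: "(i, j) \<in> triangle n"
  shows "displaced n (update m i j x)
    = insert (i + x, j + x) (displaced n m - {(i + m i j, j + m i j)})"
proof -
  let ?f = "\<lambda>m. \<lambda>(i, j). (i + m i j, j + m i j) :: nat \<times> nat"
  have tri: "triangle n = insert (i, j) (triangle n - {(i, j)})" using t by auto
  have "displaced n (update m i j x)
      = insert (i + x, j + x) (?f (update m i j x) ` (triangle n - {(i, j)}))"
    unfolding displaced_def by (subst tri, subst image_insert) (simp add: update_apply)
  also have "?f (update m i j x) ` (triangle n - {(i, j)}) = ?f m ` (triangle n - {(i, j)})"
    by (rule image_cong) (auto simp: update_apply split: if_splits)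
  also have "\<dots> = ?f m ` triangle n - ?f m ` {(i, j)}"
    by (rule inj_on_image_set_diff[OF inj_on_displace[OF m]]) (use t in auto)
  finally show ?thesis by (simp add: displaced_def)
qed

lemma displaced_in_triangle:
  assumes m: "m \<in> displacements n k" and t: "(i, j) \<in> triangle n" and s: "s \<le> m i j"
  shows "(i + s, j + s) \<in> triangle (n + 2 * k)"
  using assms by (force simp: displacements_def triangle_def)

text \<open>
  Vacancy of the squares to the right and below says that the right and lower neighbours have
  already slid further than the moving square, so raising its entry by one keeps \<open>m\<close> weakly
  increasing. The bound \<open>k\<close> is passed down from the outermost antidiagonal \<open>i + j = n\<close>, where it is
  the condition that the square stays inside the large staircase.
\<close>

lemma excited_move_displacement:
  assumes m: "m \<in> displacements n k"
    and mv: "excited_move (triangle (n + 2 * k)) (displaced n m) D'"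
  shows "\<exists>m' \<in> displacements n k. D' = displaced n m'"
  using mv
proof cases
  case (1 a b)
  then obtain i j where t: "(i, j) \<in> triangle n" and ab: "a = i + m i j" "b = j + m i j"
    by (auto simp: displaced_def)
  have down: "m i j + 1 \<le> m (i + 1) j" if "(i + 1, j) \<in> triangle n"
  proof -
    have "m (i + 1) j \<noteq> m i j"
      using 1(3) that unfolding displaced_def ab by force
    then show ?thesis using displacements_mono[OF m that, of i j] by simp
  qed
  have right: "m i j + 1 \<le> m i (j + 1)" if "(i, j + 1) \<in> triangle n"
  proof -
    have "m i (j + 1) \<noteq> m i j"
      using 1(4) that unfolding displaced_def ab by force
    then show ?thesis using displacements_mono[OF m that, of i j] by simp
  qed
  have k: "m i j + 1 \<le> k"
  proof (cases "(i + 1, j) \<in> triangle n")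
    case True
    moreover have "m (i + 1) j \<le> k" using True m by (auto simp: displacements_def)
    ultimately show ?thesis using down by simp
  next
    case False
    then have "i + j = n" using t by (auto simp: triangle_def)
    then show ?thesis using 1(6) ab by (auto simp: triangle_def)
  qed
  have "barrier m i j \<le> m i j" using m t by (auto simp: displacements_def)
  then have "update m i j (m i j + 1) \<in> displacements n k"
    using k down right by (intro update_in_displacements[OF m t]) simp_all
  moreover have "D' = displaced n (update m i j (m i j + 1))"
    unfolding displaced_update[OF m t] 1(1) ab by simp
  ultimately show ?thesis by blast
qed

text \<open>
  The last move is undone by lowering a nonzero entry with \<open>i + j\<close> minimal. Its preceding neighbours
  are zero, so the result is again weakly increasing.
\<close>

lemma displaced_reachable:
  assumes "m \<in> displacements n k"
  shows "(excited_move (triangle (n + 2 * k)))\<^sup>*\<^sup>* (triangle n) (displaced n m)"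
  using assms
proof (induction "\<Sum>(i, j)\<in>triangle n. m i j" arbitrary: m rule: less_induct)
  case less
  note m = less.prems
  show ?case
  proof (cases "\<forall>(i, j)\<in>triangle n. m i j = 0")
    case True
    then have "displaced n m = id ` triangle n"
      unfolding displaced_def by (intro image_cong) auto
    then show ?thesis by simp
  next
    case False
    define Q where "Q = (\<lambda>s. \<exists>i j. (i, j) \<in> triangle n \<and> 0 < m i j \<and> s = i + j)"
    have "\<exists>s. Q s" using False by (auto simp: Q_def)
    then obtain s where "Q s" and least: "\<And>s'. s' < s \<Longrightarrow> \<not> Q s'"
      using exists_least_iff[of Q] by auto
    from \<open>Q s\<close> obtain i j where t: "(i, j) \<in> triangle n" and pos: "0 < m i j" and s: "s = i + j"
      by (auto simp: Q_def)
    have min: "m i' j' = 0" if "(i', j') \<in> triangle n" "i' + j' < i + j" for i' j'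
      using least[of "i' + j'"] that s by (auto simp: Q_def)
    have min': "m i' j' = 0" if "i' + j' < i + j" for i' j'
      using min m that by (cases "(i', j') \<in> triangle n") (auto simp: displacements_def)
    define v where "v = m i j - 1"
    have v: "m i j = v + 1" using pos by (simp add: v_def)
    define m1 where "m1 = update m i j v"
    have ij: "1 \<le> i" "1 \<le> j" using t by (auto simp: triangle_def)
    have "barrier m i j = 0" using ij by (auto simp: barrier_def intro!: min')
    moreover have "m i j \<le> k" using m t by (auto simp: displacements_def)
    moreover have "v \<le> m (i + 1) j" if "(i + 1, j) \<in> triangle n"
      using displacements_mono[OF m that, of i j] v by simp
    moreover have "v \<le> m i (j + 1)" if "(i, j + 1) \<in> triangle n"
      using displacements_mono[OF m that, of i j] v by simp
    ultimately have m1: "m1 \<in> displacements n k"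
      unfolding m1_def using v by (intro update_in_displacements[OF m t]) auto
    have restore: "m = update m1 i j (v + 1)"
      using v by (auto simp: m1_def update_def fun_eq_iff)
    have m1v: "m1 i j = v" by (simp add: m1_def update_apply)
    have "(\<Sum>(i, j)\<in>triangle n. m1 i j) < (\<Sum>(i, j)\<in>triangle n. m i j)"
      by (rule sum_strict_mono_ex1) (use t v in \<open>auto simp: m1_def update_apply intro!: bexI[of _ "(i, j)"]\<close>)
    note IH = less.hyps[OF this m1]
    \<comment> \<open>The vacancies: a square starting weakly beyond \<open>(i, j)\<close> has slid by at least \<open>v + 1\<close> and so
      is too far out, and one that could only arrive from before \<open>(i, j)\<close> has not moved.\<close>
    have large: "v + 1 \<le> m1 i' j'" if "(i', j') \<in> triangle n" "i \<le> i'" "j \<le> j'" "(i', j') \<noteq> (i, j)" for i' j'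
      using displacements_mono[OF m that(1-3)] that(4) v by (auto simp: m1_def update_apply)
    have small: "m1 i' j' = 0" if "i' + j' < i + j" for i' j'
      using min'[OF that] that by (auto simp: m1_def update_apply)
    have notin: "(i + v + p, j + v + q) \<notin> displaced n m1" if pq: "p \<le> 1" "q \<le> 1" "p + q \<noteq> 0" for p q
    proof
      assume "(i + v + p, j + v + q) \<in> displaced n m1"
      then obtain i' j' where t': "(i', j') \<in> triangle n"
        and e: "i + v + p = i' + m1 i' j'" "j + v + q = j' + m1 i' j'"
        by (auto simp: displaced_def)
      show False
      proof (cases "i \<le> i' \<and> j \<le> j'")
        case True
        show False
        proof (cases "(i', j') = (i, j)")
          case True
          then show False using e pq m1v by auto
        next
          case False
          from large[OF t' _ _ False] True have "v + 1 \<le> m1 i' j'" by simp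
          then show False using e True False pq by auto
        qed
      next
        case False
        then have "i' + j' < i + j" using e pq by linarith
        then show False using small e False by simp
      qed
    qed
    have "excited_move (triangle (n + 2 * k)) (displaced n m1)
        (insert (i + v + 1, j + v + 1) (displaced n m1 - {(i + v, j + v)}))"
    proof (rule excited_move.intros)
      show "(i + v, j + v) \<in> displaced n m1"
        unfolding displaced_def using t m1v by force
      show "(i + v + 1, j + v + 1) \<in> triangle (n + 2 * k)"
        using displaced_in_triangle[OF m t, of "v + 1"] v by simp
    qed (use notin[of 1 0] notin[of 0 1] notin[of 1 1] in auto)
    then have "excited_move (triangle (n + 2 * k)) (displaced n m1) (displaced n m)"
      by (subst restore, subst displaced_update[OF m1 t]) (simp add: m1v add.assoc)
    with IH show ?thesis by simp
  qed
qed

lemma zero_in_displacements: "(\<lambda>i j. 0) \<in> displacements n k"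
  by (simp add: displacements_def barrier_def)

lemma excited_diagrams_staircase:
  "excited_diagrams (staircase (n + 2 * k)) (staircase n) = displaced n ` displacements n k"
proof -
  let ?R = "excited_move (triangle (n + 2 * k))"
  have "\<exists>m\<in>displacements n k. D = displaced n m" if "?R\<^sup>*\<^sup>* (triangle n) D" for D
    using that
  proof (induction rule: rtranclp_induct)
    case base
    have "triangle n = displaced n (\<lambda>i j. 0)" by (force simp: displaced_def)
    then show ?case using zero_in_displacements by blast
  next
    case (step y z)
    then show ?case using excited_move_displacement by blast
  qed
  then show ?thesis
    using displaced_reachable by (auto simp: excited_diagrams_def diagram_staircase)
qed

text \<open>
  Characterises \<open>m\<close> as the least displacement avoiding \<open>P\<close>, square by square: starting from its
  barrier, a square slides on until it first leaves \<open>P\<close>.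
\<close>

definition tight :: "nat \<Rightarrow> square set \<Rightarrow> (nat \<Rightarrow> nat \<Rightarrow> nat) \<Rightarrow> bool" where
  "tight n P m \<longleftrightarrow> (\<forall>(i, j)\<in>triangle n. (i + m i j, j + m i j) \<notin> P
     \<and> (\<forall>s. barrier m i j \<le> s \<and> s < m i j \<longrightarrow> (i + s, j + s) \<in> P))"

lemma tight_exists:
  assumes "m0 \<in> displacements n k" "displaced n m0 \<inter> P = {}"
  shows "\<exists>m \<in> displacements n k. tight n P m"
proof -
  let ?ok = "\<lambda>m. m \<in> displacements n k \<and> displaced n m \<inter> P = {}"
  let ?size = "\<lambda>m. \<Sum>(i, j)\<in>triangle n. m i j"
  obtain m where ok: "?ok m" and min: "\<And>m'. ?ok m' \<Longrightarrow> ?size m \<le> ?size m'"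
    using ex_has_least_nat[of ?ok m0 ?size] assms by blast
  then have m: "m \<in> displacements n k" and dis: "displaced n m \<inter> P = {}" by auto
  have "(i + s, j + s) \<in> P" if t: "(i, j) \<in> triangle n" and s: "barrier m i j \<le> s" "s < m i j" for i j s
  proof (rule ccontr)
    assume notP: "(i + s, j + s) \<notin> P"
    have "m i j \<le> k" using m t by (auto simp: displacements_def)
    moreover have "s \<le> m (i + 1) j" if "(i + 1, j) \<in> triangle n"
      using displacements_mono[OF m that, of i j] s by simp
    moreover have "s \<le> m i (j + 1)" if "(i, j + 1) \<in> triangle n"
      using displacements_mono[OF m that, of i j] s by simp
    ultimately have "update m i j s \<in> displacements n k"
      using s by (intro update_in_displacements[OF m t]) auto
    moreover have "displaced n (update m i j s) \<inter> P = {}"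
      using dis notP by (auto simp: displaced_update[OF m t])
    ultimately have "?size m \<le> ?size (update m i j s)" using min by simp
    moreover have "?size (update m i j s) < ?size m"
      by (rule sum_strict_mono_ex1)
        (use t s in \<open>auto simp: update_apply intro!: bexI[of _ "(i, j)"]\<close>)
    ultimately show False by simp
  qed
  then have "tight n P m" using dis by (force simp: tight_def displaced_def)
  then show ?thesis using m by blast
qed

lemma tight_unique:
  assumes m: "m \<in> displacements n k" "tight n P m" and m': "m' \<in> displacements n k" "tight n P m'"
  shows "m = m'"
proof -
  have "m i j = m' i j" for i j
  proof (induction "i + j" arbitrary: i j rule: less_induct)
    case less
    show ?case
    proof (cases "(i, j) \<in> triangle n")
      case False
      then show ?thesis using m m' by (auto simp: displacements_def)
    next
      case True
      then have "1 \<le> i" "1 \<le> j" by (auto simp: triangle_def)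
      then have b: "barrier m i j = barrier m' i j" using less by (simp add: barrier_def)
      have "barrier m i j \<le> m i j" "barrier m' i j \<le> m' i j"
        using True m m' by (auto simp: displacements_def)
      then show ?thesis
        using True m(2) m'(2) b unfolding tight_def
        by (metis (mono_tags, lifting) case_prod_conv linorder_neqE_nat)
    qed
  qed
  then show ?thesis by blast
qed

definition excess :: "nat \<Rightarrow> (nat \<Rightarrow> nat \<Rightarrow> nat) \<Rightarrow> nat" where
  "excess n m = (\<Sum>(i, j)\<in>triangle n. m i j - barrier m i j)"

lemma card_between:
  assumes "finite A" "T \<subseteq> A" "F \<subseteq> A" "T \<inter> F = {}"
  shows "card {P. P \<subseteq> A \<and> T \<subseteq> P \<and> F \<inter> P = {}} = 2 ^ (card A - card T - card F)"
proof -
  have "{P. P \<subseteq> A \<and> T \<subseteq> P \<and> F \<inter> P = {}} = (\<lambda>S. T \<union> S) ` Pow (A - T - F)"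
  proof (intro equalityI subsetI)
    fix P assume "P \<in> {P. P \<subseteq> A \<and> T \<subseteq> P \<and> F \<inter> P = {}}"
    then have "P = T \<union> (P - T)" "P - T \<in> Pow (A - T - F)" by auto
    then show "P \<in> (\<lambda>S. T \<union> S) ` Pow (A - T - F)" by blast
  qed (use assms in auto)
  moreover have "inj_on (\<lambda>S. T \<union> S) (Pow (A - T - F))" by (rule inj_onI) blast
  moreover have "card (A - T - F) = card A - card T - card F"
    using assms by (subst card_Diff_subset, auto intro: finite_subset)+
  ultimately show ?thesis
    using assms by (simp add: card_image card_Pow)
qed

text \<open>
  The places a square passes after its barrier are forced to lie in \<open>P\<close>, and its final place is
  forced to lie outside. All these places are distinct, and membership of the remaining squares of
  \<open>\<Lambda>\<close> is free.
\<close>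

lemma card_tight:
  assumes m: "m \<in> displacements n k"
  defines "\<Lambda> \<equiv> triangle (n + 2 * k)"
  shows "card {P. P \<subseteq> \<Lambda> \<and> tight n P m} = 2 ^ (card \<Lambda> - card (triangle n) - excess n m)"
    and "excess n m + card (triangle n) \<le> card \<Lambda>"
proof -
  define S where "S = Sigma (triangle n) (\<lambda>(i, j). {barrier m i j..<m i j})"
  define T where "T = (\<lambda>((i, j), s). (i + s, j + s)) ` S"
  have bm: "barrier m i j \<le> m i j" if "(i, j) \<in> triangle n" for i j
    using m that by (auto simp: displacements_def)
  let ?f = "\<lambda>((i, j), s). (i + s, j + s) :: square"
  have "inj_on ?f S"
  proof (rule inj_onI)
    fix x y assume "x \<in> S" "y \<in> S" "?f x = ?f y"
    then show "x = y"
      using diagonal_ranges_disjoint[OF m, of "fst (fst x)" "snd (fst x)" "fst (fst y)"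
          "snd (fst y)" "snd x" "snd y"]
      by (auto simp: S_def split: prod.splits)
  qed
  then have cT: "card T = excess n m"
    by (simp add: T_def card_image S_def card_SigmaI excess_def case_prod_unfold)
  have cD: "card (displaced n m) = card (triangle n)"
    unfolding displaced_def by (rule card_image[OF inj_on_displace[OF m]])
  have TL: "T \<subseteq> \<Lambda>" and DL: "displaced n m \<subseteq> \<Lambda>"
    using displaced_in_triangle[OF m] by (auto simp: T_def S_def displaced_def \<Lambda>_def)
  have disj: "T \<inter> displaced n m = {}"
  proof -
    have False if "(i, j) \<in> triangle n" "barrier m i j \<le> s" "s < m i j" "(i', j') \<in> triangle n"
      "i + s = i' + m i' j'" "j + s = j' + m i' j'" for i j s i' j'
      using diagonal_ranges_disjoint[OF m that(1,4,2) _ bm[OF that(4)] _ that(5,6)] that by auto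
    then show ?thesis by (fastforce simp: T_def S_def displaced_def)
  qed
  have fin: "finite \<Lambda>" by (simp add: \<Lambda>_def)
  have "tight n P m \<longleftrightarrow> T \<subseteq> P \<and> displaced n m \<inter> P = {}" for P
    by (fastforce simp: tight_def T_def S_def displaced_def)
  then have "{P. P \<subseteq> \<Lambda> \<and> tight n P m} = {P. P \<subseteq> \<Lambda> \<and> T \<subseteq> P \<and> displaced n m \<inter> P = {}}"
    by blast
  also have "card \<dots> = 2 ^ (card \<Lambda> - card T - card (displaced n m))"
    by (rule card_between[OF fin TL DL disj])
  finally show "card {P. P \<subseteq> \<Lambda> \<and> tight n P m} = 2 ^ (card \<Lambda> - card (triangle n) - excess n m)"
    by (simp add: cT cD add.commute diff_diff_add)
  have "card T + card (displaced n m) = card (T \<union> displaced n m)"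
    using disj finite_subset[OF TL fin] finite_subset[OF DL fin] by (simp add: card_Un_disjoint)
  also have "\<dots> \<le> card \<Lambda>" using TL DL fin by (intro card_mono) auto
  finally show "excess n m + card (triangle n) \<le> card \<Lambda>" by (simp add: cT cD)
qed

lemma finite_bounded_functions:
  assumes "finite I"
  shows "finite {f :: 'a \<Rightarrow> nat. (\<forall>i. f i \<le> k) \<and> (\<forall>i. i \<notin> I \<longrightarrow> f i = 0)}"
proof -
  have "finite {f :: 'a \<Rightarrow> nat. \<forall>x. (x \<in> I \<longrightarrow> f x \<in> {..k}) \<and> (x \<notin> I \<longrightarrow> f x = 0)}"
    by (rule finite_set_of_finite_funs) (use assms in auto)
  then show ?thesis by (rule rev_finite_subset) auto
qed

lemma finite_displacements [simp]: "finite (displacements n k)"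
proof -
  have "case_prod ` displacements n k \<subseteq> {f. (\<forall>c. f c \<le> k) \<and> (\<forall>c. c \<notin> triangle n \<longrightarrow> f c = 0)}"
    by (auto simp: displacements_def) (metis le0)
  then have "finite (case_prod ` displacements n k)"
    using finite_bounded_functions[OF finite_triangle] finite_subset by blast
  then show ?thesis
    by (rule finite_imageD) (auto simp: inj_on_def fun_eq_iff)
qed

lemma card_triangle: "2 * card (triangle n) = n * (n - 1)"
proof -
  have "triangle n = Sigma {1..<n} (\<lambda>i. {1..n - i})" by (auto simp: triangle_def)
  then have "card (triangle n) = (\<Sum>i\<in>{1..<n}. n - i)" by simp
  also have "\<dots> = \<Sum>{0..<n}"
    by (rule sum.reindex_bij_witness_not_neutral[of "{}" "{0}" _ "\<lambda>i. n - i" "\<lambda>i. n - i"]) auto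
  finally have "card (triangle n) = n * (n - 1) div 2" by (simp add: Sum_Ico_nat)
  moreover have "even (n * (n - 1))" by (cases n) auto
  ultimately show ?thesis by simp
qed

lemma num_pleasant_staircase:
  "rat_of_nat (num_pleasant (staircase (n + 2 * k)) (staircase n))
    = 2 ^ (card (triangle (n + 2 * k)) - card (triangle n))
      * (\<Sum>m\<in>displacements n k. (1 / 2) ^ excess n m)"
proof -
  let ?L = "triangle (n + 2 * k)"
  let ?d = "card ?L - card (triangle n)"
  have "pleasant_diagrams (staircase (n + 2 * k)) (staircase n)
      = (\<Union>m\<in>displacements n k. {P. P \<subseteq> ?L \<and> tight n P m})" (is "?A = ?B")
  proof (intro equalityI subsetI)
    fix P assume "P \<in> ?A"
    then obtain m where "m \<in> displacements n k" "P \<subseteq> ?L - displaced n m"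
      by (auto simp: pleasant_diagrams_def excited_diagrams_staircase diagram_staircase)
    then show "P \<in> ?B" using tight_exists[of m n k P] by blast
  next
    fix P assume "P \<in> ?B"
    then obtain m where "m \<in> displacements n k" "P \<subseteq> ?L" "tight n P m" by auto
    moreover from this have "displaced n m \<inter> P = {}" by (auto simp: tight_def displaced_def)
    ultimately show "P \<in> ?A"
      by (auto simp: pleasant_diagrams_def excited_diagrams_staircase diagram_staircase)
  qed
  then have "num_pleasant (staircase (n + 2 * k)) (staircase n)
      = (\<Sum>m\<in>displacements n k. card {P. P \<subseteq> ?L \<and> tight n P m})"
    unfolding num_pleasant_def
    by (simp, intro card_UN_disjoint) (auto intro: tight_unique finite_subset[of _ "Pow ?L"])
  also have "rat_of_nat \<dots> = (\<Sum>m\<in>displacements n k. 2 ^ ?d * (1 / 2) ^ excess n m)"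
    unfolding of_nat_sum
  proof (rule sum.cong[OF refl])
    fix m assume m: "m \<in> displacements n k"
    have "excess n m \<le> ?d" using card_tight(2)[OF m] by simp
    then have "(2 :: rat) ^ (?d - excess n m) = 2 ^ ?d * (1 / 2) ^ excess n m"
      by (simp add: power_diff power_one_over del: diff_diff_left)
    then show "rat_of_nat (card {P. P \<subseteq> ?L \<and> tight n P m}) = 2 ^ ?d * (1 / 2) ^ excess n m"
      by (simp add: card_tight(1)[OF m])
  qed
  finally show ?thesis by (simp add: sum_distrib_left)
qed

section \<open>Growth diagrams on the staircase\<close>

text \<open>
  A partition is encoded as the function listing its parts, padded by zeros; \<open>parts k i\<close> holds
  those with parts at most \<open>k\<close> and at most \<open>i\<close> of them.
\<close>

definition parts :: "nat \<Rightarrow> nat \<Rightarrow> (nat \<Rightarrow> nat) set" where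
  "parts k i = {\<rho>. antimono \<rho> \<and> \<rho> 0 \<le> k \<and> (\<forall>j\<ge>i. \<rho> j = 0)}"

text \<open>
  \<open>\<mu>\<close> arises from \<open>\<kappa>\<close> by adding a horizontal strip.
\<close>

definition interlaces :: "(nat \<Rightarrow> nat) \<Rightarrow> (nat \<Rightarrow> nat) \<Rightarrow> bool" (infix "\<prec>" 50) where
  "\<kappa> \<prec> \<mu> \<longleftrightarrow> (\<forall>j. \<kappa> j \<le> \<mu> j \<and> \<mu> (Suc j) \<le> \<kappa> j)"

definition weight :: "(nat \<Rightarrow> nat) \<Rightarrow> nat" where
  "weight \<rho> = (\<Sum>j | \<rho> j \<noteq> 0. \<rho> j)"

lemma weight_eq:
  assumes "\<And>j. j \<ge> N \<Longrightarrow> \<rho> j = 0"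
  shows "weight \<rho> = (\<Sum>j<N. \<rho> j)"
  unfolding weight_def
  by (rule sum.mono_neutral_left) (use assms in \<open>auto intro: ccontr\<close>)

lemma weight_zero [simp]: "weight (\<lambda>_. 0) = 0"
  by (simp add: weight_def)

lemma finite_parts [simp]: "finite (parts k i)"
proof (rule finite_subset)
  show "parts k i \<subseteq> {f. (\<forall>j. f j \<le> k) \<and> (\<forall>j. j \<notin> {..<i} \<longrightarrow> f j = 0)}"
    by (auto simp: parts_def intro: order_trans[OF antimonoD])
qed (rule finite_bounded_functions, simp)

lemma parts_mono: "i \<le> i' \<Longrightarrow> \<rho> \<in> parts k i \<Longrightarrow> \<rho> \<in> parts k i'"
  by (auto simp: parts_def)

lemma zero_in_parts [simp]: "(\<lambda>_. 0) \<in> parts k i"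
  by (auto simp: parts_def antimono_def)

lemma interlaces_antimono:
  assumes "\<kappa> \<prec> \<mu>" shows "antimono \<kappa>" "antimono \<mu>"
proof -
  have "\<kappa> (Suc j) \<le> \<kappa> j" "\<mu> (Suc j) \<le> \<mu> j" for j
    using assms by (meson interlaces_def order_trans)+
  then show "antimono \<kappa>" "antimono \<mu>" by (auto intro: decseq_SucI)
qed

lemma interlaces_parts:
  assumes "\<kappa> \<prec> \<mu>" "\<mu> \<in> parts k i" shows "\<kappa> \<in> parts k i"
proof -
  have "\<kappa> j \<le> \<mu> j" for j using assms by (auto simp: interlaces_def)
  then show ?thesis using assms interlaces_antimono[OF assms(1)]
    by (auto simp: parts_def) (metis le_trans, metis le_zero_eq)
qed

lemma interlaces_zero [simp]: "\<kappa> \<prec> (\<lambda>_. 0) \<longleftrightarrow> \<kappa> = (\<lambda>_. 0)"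
  by (auto simp: interlaces_def)

lemma weight_mono:
  assumes "\<kappa> \<prec> \<mu>" "\<mu> \<in> parts k i"
  shows "weight \<kappa> \<le> weight \<mu>"
proof -
  have "\<kappa> \<in> parts k i" using interlaces_parts[OF assms] .
  then show ?thesis
    using assms weight_eq[of i \<kappa>] weight_eq[of i \<mu>]
    by (auto simp: parts_def interlaces_def intro!: sum_mono)
qed

definition below_weight :: "'a::comm_ring_1 \<Rightarrow> (nat \<Rightarrow> nat) \<Rightarrow> (nat \<Rightarrow> nat) \<Rightarrow> (nat \<Rightarrow> nat) \<Rightarrow> 'a" where
  "below_weight w \<kappa> \<mu> \<nu> = (if \<kappa> \<prec> \<mu> \<and> \<kappa> \<prec> \<nu> then w ^ (weight \<nu> - weight \<kappa>) else 0)"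

text \<open>
  The weight of passing from \<open>\<mu>\<close> to \<open>\<nu>\<close> by removing a horizontal strip and then adding one, where
  each added box counts \<open>w\<close>.
\<close>

definition transfer_weight :: "'a::comm_ring_1 \<Rightarrow> (nat \<Rightarrow> nat) \<Rightarrow> (nat \<Rightarrow> nat) \<Rightarrow> 'a" where
  "transfer_weight w \<mu> \<nu> = (\<Sum>\<kappa> | \<kappa> \<prec> \<mu> \<and> \<kappa> \<prec> \<nu>. w ^ (weight \<nu> - weight \<kappa>))"

lemma transfer_weight_eq:
  assumes "finite B" "\<And>\<kappa>. \<kappa> \<prec> \<mu> \<Longrightarrow> \<kappa> \<prec> \<nu> \<Longrightarrow> \<kappa> \<in> B"
  shows "transfer_weight w \<mu> \<nu> = (\<Sum>\<kappa>\<in>B. below_weight w \<kappa> \<mu> \<nu>)"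
  unfolding transfer_weight_def below_weight_def
  by (rule sum.mono_neutral_cong_left) (use assms in auto)

text \<open>
  Contribution of a square with last passage time \<open>v\<close> whose preceding neighbours have last passage
  times \<open>a\<close> and \<open>b\<close>.
\<close>

definition growth :: "'a::comm_ring_1 \<Rightarrow> nat \<Rightarrow> nat \<Rightarrow> nat \<Rightarrow> 'a" where
  "growth w a b v = (if max a b \<le> v then w ^ (v - max a b) else 0)"

text \<open>
  Fomin's local rule. A partition \<open>\<rho>\<close> lying above \<open>\<mu>\<close> and \<open>\<nu>\<close> has its part \<open>\<rho> (j + 1)\<close> in the interval
  from \<open>lo j = max (\<mu> (j + 1)) (\<nu> (j + 1))\<close> to \<open>hi j = min (\<mu> j) (\<nu> j)\<close>, and a partition \<open>\<kappa>\<close> below both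
  has \<open>\<kappa> j\<close> in the same interval. Reflecting every interval matches the \<open>\<rho>\<close> with a given first part
  with the \<open>\<kappa>\<close>, and the excess of \<open>\<rho> 0\<close> over \<open>max (\<mu> 0) (\<nu> 0)\<close> accounts for the change of weight.
\<close>

lemma local_growth_rule:
  fixes w :: "'a::comm_ring_1"
  assumes \<mu>: "\<mu> \<in> parts k i" and \<nu>: "\<nu> \<in> parts k (Suc i)" and v: "v \<le> k"
  shows "(\<Sum>\<rho> | \<rho> \<in> parts k (Suc i) \<and> \<rho> 0 = v \<and> \<mu> \<prec> \<rho> \<and> \<nu> \<prec> \<rho>. w ^ (weight \<rho> - weight \<mu>))
    = growth w (\<mu> 0) (\<nu> 0) v * transfer_weight w \<mu> \<nu>"
proof (cases "max (\<mu> 0) (\<nu> 0) \<le> v")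
  case False
  then have "{\<rho> \<in> parts k (Suc i). \<rho> 0 = v \<and> \<mu> \<prec> \<rho> \<and> \<nu> \<prec> \<rho>} = {}"
    by (auto simp: interlaces_def)
  then show ?thesis using False by (simp only: growth_def) simp
next
  case True
  define lo where "lo j = max (\<mu> (Suc j)) (\<nu> (Suc j))" for j
  define hi where "hi j = min (\<mu> j) (\<nu> j)" for j
  define up where "up \<kappa> = (\<lambda>j. case j of 0 \<Rightarrow> v | Suc j \<Rightarrow> hi j + lo j - \<kappa> j)" for \<kappa> :: "nat \<Rightarrow> nat"
  define down where "down \<rho> = (\<lambda>j. hi j + lo j - \<rho> (Suc j))" for \<rho> :: "nat \<Rightarrow> nat"
  have below: "\<kappa> \<prec> \<mu> \<and> \<kappa> \<prec> \<nu> \<longleftrightarrow> (\<forall>j. lo j \<le> \<kappa> j \<and> \<kappa> j \<le> hi j)" for \<kappa>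
    by (auto simp: interlaces_def lo_def hi_def)
  have above: "\<mu> \<prec> \<rho> \<and> \<nu> \<prec> \<rho> \<longleftrightarrow> max (\<mu> 0) (\<nu> 0) \<le> \<rho> 0 \<and> (\<forall>j. lo j \<le> \<rho> (Suc j) \<and> \<rho> (Suc j) \<le> hi j)"
    for \<rho>
  proof
    assume r: "max (\<mu> 0) (\<nu> 0) \<le> \<rho> 0 \<and> (\<forall>j. lo j \<le> \<rho> (Suc j) \<and> \<rho> (Suc j) \<le> hi j)"
    have "\<mu> j \<le> \<rho> j \<and> \<nu> j \<le> \<rho> j" for j
      using r by (cases j) (auto simp: lo_def)
    then show "\<mu> \<prec> \<rho> \<and> \<nu> \<prec> \<rho>" using r by (auto simp: interlaces_def hi_def)
  qed (auto simp: interlaces_def lo_def hi_def)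
  have hi0: "hi j = 0" if "j \<ge> i" for j using \<mu> that by (simp add: hi_def parts_def)
  let ?A = "{\<kappa>. \<kappa> \<prec> \<mu> \<and> \<kappa> \<prec> \<nu>}"
  let ?B = "{\<rho>. \<rho> \<in> parts k (Suc i) \<and> \<rho> 0 = v \<and> \<mu> \<prec> \<rho> \<and> \<nu> \<prec> \<rho>}"
  have up: "up \<kappa> \<in> ?B" and ud: "down (up \<kappa>) = \<kappa>" if "\<kappa> \<in> ?A" for \<kappa>
  proof -
    have b: "lo j \<le> \<kappa> j \<and> \<kappa> j \<le> hi j" for j using that below by blast
    have i: "\<mu> \<prec> up \<kappa> \<and> \<nu> \<prec> up \<kappa>"
    proof -
      have "lo j \<le> hi j + lo j - \<kappa> j \<and> hi j + lo j - \<kappa> j \<le> hi j" for j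
        using b[of j] by linarith
      then show ?thesis unfolding above using True by (simp add: up_def)
    qed
    have "up \<kappa> j = 0" if "j \<ge> Suc i" for j
    proof (cases j)
      case (Suc j')
      then have "hi j' = 0" using that hi0 by simp
      then show ?thesis using b[of j'] Suc by (simp add: up_def)
    qed (use that in simp)
    then show "up \<kappa> \<in> ?B" using v i interlaces_antimono[of \<mu> "up \<kappa>"]
      by (auto simp: parts_def up_def)
    show "down (up \<kappa>) = \<kappa>" using b by (auto simp: down_def up_def fun_eq_iff diff_diff_cancel trans_le_add1)
  qed
  have down: "down \<rho> \<in> ?A" and du: "up (down \<rho>) = \<rho>" if "\<rho> \<in> ?B" for \<rho>
  proof -
    have b: "lo j \<le> \<rho> (Suc j) \<and> \<rho> (Suc j) \<le> hi j" and z: "\<rho> 0 = v" for j using that above by blast+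
    have "lo j \<le> down \<rho> j \<and> down \<rho> j \<le> hi j" for j using b[of j] by (auto simp: down_def)
    then show "down \<rho> \<in> ?A" using below by blast
    show "up (down \<rho>) = \<rho>" using b z
      by (auto simp: down_def up_def fun_eq_iff diff_diff_cancel trans_le_add1 split: nat.split)
  qed
  have w: "weight (up \<kappa>) - weight \<mu> = (v - max (\<mu> 0) (\<nu> 0)) + (weight \<nu> - weight \<kappa>)" if \<kappa>: "\<kappa> \<in> ?A" for \<kappa>
  proof -
    have b: "lo j \<le> \<kappa> j \<and> \<kappa> j \<le> hi j" for j using \<kappa> below by blast
    have z\<mu>: "\<mu> j = 0" if "j \<ge> i" for j using \<mu> that by (simp add: parts_def)
    have z\<nu>: "\<nu> j = 0" if "j \<ge> Suc i" for j using \<nu> that by (simp add: parts_def)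
    have z\<kappa>: "\<kappa> j = 0" if "j \<ge> i" for j using b[of j] hi0[OF that] by simp
    have zu: "up \<kappa> j = 0" if "j \<ge> Suc i" for j using up[OF \<kappa>] that by (simp add: parts_def)
    have "weight (up \<kappa>) = (\<Sum>j<Suc i. up \<kappa> j)" by (rule weight_eq) (rule zu)
    also have "\<dots> = v + (\<Sum>j<i. hi j + lo j - \<kappa> j)"
      by (subst sum.lessThan_Suc_shift) (simp add: up_def)
    finally have wu: "weight (up \<kappa>) = v + (\<Sum>j<i. hi j + lo j - \<kappa> j)" .
    have w\<kappa>: "weight \<kappa> = (\<Sum>j<i. \<kappa> j)" by (rule weight_eq) (rule z\<kappa>)
    have "(\<Sum>j<i. hi j + lo j - \<kappa> j) + (\<Sum>j<i. \<kappa> j) = (\<Sum>j<i. hi j + lo j)"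
      unfolding sum.distrib[symmetric] using b by (intro sum.cong) (auto simp: trans_le_add1)
    also have "\<dots> = (\<Sum>j<i. hi j) + (\<Sum>j<i. lo j)" by (rule sum.distrib)
    finally have s1: "weight (up \<kappa>) + weight \<kappa> = v + (\<Sum>j<i. hi j) + (\<Sum>j<i. lo j)"
      using wu w\<kappa> by simp
    have "weight \<mu> + weight \<nu> = (\<Sum>j<Suc i. \<mu> j) + (\<Sum>j<Suc i. \<nu> j)"
      using weight_eq[of "Suc i" \<mu>] weight_eq[of "Suc i" \<nu>] z\<mu> z\<nu> by simp
    also have "\<dots> = (\<Sum>j<Suc i. max (\<mu> j) (\<nu> j)) + (\<Sum>j<Suc i. hi j)"
      unfolding sum.distrib[symmetric] by (intro sum.cong) (auto simp: hi_def)
    also have "(\<Sum>j<Suc i. max (\<mu> j) (\<nu> j)) = max (\<mu> 0) (\<nu> 0) + (\<Sum>j<i. lo j)"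
      by (subst sum.lessThan_Suc_shift) (simp add: lo_def)
    also have "(\<Sum>j<Suc i. hi j) = (\<Sum>j<i. hi j)" using hi0 by simp
    finally have "weight (up \<kappa>) + weight \<kappa> + max (\<mu> 0) (\<nu> 0) = v + weight \<mu> + weight \<nu>"
      using s1 by simp
    moreover have "weight \<mu> \<le> weight (up \<kappa>)" using up[OF \<kappa>] weight_mono by blast
    moreover have "weight \<kappa> \<le> weight \<nu>" using \<kappa> \<nu> weight_mono by blast
    ultimately show ?thesis using True by linarith
  qed
  have "growth w (\<mu> 0) (\<nu> 0) v * transfer_weight w \<mu> \<nu>
      = (\<Sum>\<kappa>\<in>?A. w ^ (v - max (\<mu> 0) (\<nu> 0)) * w ^ (weight \<nu> - weight \<kappa>))"
    using True by (simp add: growth_def transfer_weight_def sum_distrib_left)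
  also have "\<dots> = (\<Sum>\<rho>\<in>?B. w ^ (weight \<rho> - weight \<mu>))"
  proof (rule sum.reindex_bij_witness[of _ down up])
    fix \<kappa> assume "\<kappa> \<in> ?A"
    note \<kappa> = up[OF this] ud[OF this] w[OF this]
    show "down (up \<kappa>) = \<kappa>" "up \<kappa> \<in> ?B" by (fact \<kappa>)+
    show "w ^ (weight (up \<kappa>) - weight \<mu>)
        = w ^ (v - max (\<mu> 0) (\<nu> 0)) * w ^ (weight \<nu> - weight \<kappa>)"
      by (simp only: \<kappa>(3) power_add)
  qed (use down du in blast)+
  finally show ?thesis by simp
qed

text \<open>
  A variant of \<open>prod_sum_PiE\<close> in which the choice functions take the value \<open>d\<close> outside the index set,
  so that out-of-range neighbours can be read off as \<open>d\<close>.
\<close>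

lemma prod_sum_functions:
  fixes f :: "'i \<Rightarrow> 'b \<Rightarrow> 'a::comm_semiring_1"
  assumes "finite I" "\<And>i. i \<in> I \<Longrightarrow> finite (B i)"
  shows "(\<Prod>i\<in>I. \<Sum>y\<in>B i. f i y)
    = (\<Sum>g | (\<forall>i\<in>I. g i \<in> B i) \<and> (\<forall>i. i \<notin> I \<longrightarrow> g i = d). \<Prod>i\<in>I. f i (g i))"
proof -
  have "(\<Prod>i\<in>I. \<Sum>y\<in>B i. f i y) = (\<Sum>g\<in>PiE I B. \<Prod>i\<in>I. f i (g i))"
    by (rule prod_sum_PiE) (use assms in auto)
  also have "\<dots> = (\<Sum>g | (\<forall>i\<in>I. g i \<in> B i) \<and> (\<forall>i. i \<notin> I \<longrightarrow> g i = d). \<Prod>i\<in>I. f i (g i))"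
    by (rule sum.reindex_bij_witness[of _ "\<lambda>g i. if i \<in> I then g i else undefined" "\<lambda>g i. if i \<in> I then g i else d"])
      (auto simp: PiE_def extensional_def fun_eq_iff)
  finally show ?thesis .
qed

text \<open>
  The partitions attached to the antidiagonal \<open>i + j = n\<close>, with \<open>L i\<close> at the square \<open>(i, n - i)\<close>. The
  empty partitions at \<open>0\<close> and \<open>n\<close> are the boundary of the growth diagram. That \<open>L i\<close> has at most
  \<open>i\<close> parts follows from interlacing starting at \<open>L 0\<close>; building it in keeps all sums finite.
\<close>

definition families :: "nat \<Rightarrow> nat \<Rightarrow> (nat \<Rightarrow> nat \<Rightarrow> nat) set" where
  "families k n = {L. (\<forall>i\<in>{1..<n}. L i \<in> parts k i) \<and> (\<forall>i. i \<notin> {1..<n} \<longrightarrow> L i = (\<lambda>_. 0))}"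

definition vectors :: "nat \<Rightarrow> nat \<Rightarrow> (nat \<Rightarrow> nat) set" where
  "vectors k n = {v. (\<forall>i\<in>{1..<n}. v i \<le> k) \<and> (\<forall>i. i \<notin> {1..<n} \<longrightarrow> v i = 0)}"

definition antidiagonal :: "nat \<Rightarrow> (nat \<Rightarrow> nat \<Rightarrow> nat) \<Rightarrow> nat \<Rightarrow> nat" where
  "antidiagonal n m = (\<lambda>i. m i (n - i))"

lemma vectors_bounded: "v \<in> vectors k n \<Longrightarrow> v i \<le> k"
  by (cases "i \<in> {1..<n}") (auto simp: vectors_def)

lemma finite_vectors [simp]: "finite (vectors k n)"
proof (rule finite_subset)
  show "vectors k n \<subseteq> {f. (\<forall>i. f i \<le> k) \<and> (\<forall>i. i \<notin> {1..<n} \<longrightarrow> f i = 0)}"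
  proof
    fix v assume v: "v \<in> vectors k n"
    then have "\<forall>i. i \<notin> {1..<n} \<longrightarrow> v i = 0" by (simp add: vectors_def)
    then show "v \<in> {f. (\<forall>i. f i \<le> k) \<and> (\<forall>i. i \<notin> {1..<n} \<longrightarrow> f i = 0)}"
      using vectors_bounded[OF v] by blast
  qed
qed (rule finite_bounded_functions, simp)

lemma finite_families [simp]: "finite (families k n)"
proof -
  have "finite {L :: nat \<Rightarrow> nat \<Rightarrow> nat. \<forall>x. (x \<in> {1..<n} \<longrightarrow> L x \<in> parts k n) \<and> (x \<notin> {1..<n} \<longrightarrow> L x = (\<lambda>_. 0))}"
    by (rule finite_set_of_finite_funs) simp_all
  then show ?thesis
    by (rule rev_finite_subset) (auto simp: families_def intro: parts_mono[OF less_imp_le])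
qed

lemma antidiagonal_vectors:
  "m \<in> displacements n k \<Longrightarrow> antidiagonal n m \<in> vectors k n"
  by (auto simp: displacements_def vectors_def antidiagonal_def triangle_def)

lemma families_parts: "L \<in> families k n \<Longrightarrow> L i \<in> parts k i"
  by (cases "i \<in> {1..<n}") (auto simp: families_def)

lemma families_first: "L \<in> families k n \<Longrightarrow> (\<lambda>i. L i 0) \<in> vectors k n"
  by (auto simp: families_def vectors_def parts_def)

lemma triangle_Suc: "triangle (Suc n) = triangle n \<union> (\<lambda>i. (Suc i, n - i)) ` {..<n}"
proof -
  have "(i, j) \<in> (\<lambda>i. (Suc i, n - i)) ` {..<n}" if "(i, j) \<in> triangle (Suc n)" "(i, j) \<notin> triangle n" for i j
    using that by (intro image_eqI[of _ _ "i - 1"]) (auto simp: triangle_def)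
  then show ?thesis by (auto simp: triangle_def)
qed

lemma excess_Suc:
  "excess (Suc n) m = excess n m
    + (\<Sum>i<n. m (Suc i) (n - i) - max (antidiagonal n m i) (antidiagonal n m (Suc i)))"
proof -
  have "triangle n \<inter> (\<lambda>i. (Suc i, n - i)) ` {..<n} = {}" by (auto simp: triangle_def)
  moreover have "inj_on (\<lambda>i. (Suc i, n - i)) {..<n}" by (auto simp: inj_on_def)
  moreover have "n - Suc i = n - i - 1" for i by simp
  ultimately show ?thesis
    unfolding excess_def triangle_Suc
    by (subst sum.union_disjoint)
      (auto simp: sum.reindex barrier_def antidiagonal_def)
qed

text \<open>
  The entries on the antidiagonal \<open>i + j = n + 1\<close> are independent of each other once the previous
  antidiagonal is known, which gives the product of \<open>growth\<close> factors.
\<close>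

lemma displacements_last_antidiagonal:
  fixes w :: "'a::comm_ring_1"
  assumes V: "V \<in> vectors k (Suc n)"
  shows "(\<Sum>m | m \<in> displacements (Suc n) k \<and> antidiagonal (Suc n) m = V. w ^ excess (Suc n) m)
    = (\<Sum>m\<in>displacements n k. w ^ excess n m
        * (\<Prod>i<n. growth w (antidiagonal n m i) (antidiagonal n m (Suc i)) (V (Suc i))))"
proof -
  let ?A = "{m. m \<in> displacements (Suc n) k \<and> antidiagonal (Suc n) m = V}"
  let ?ok = "\<lambda>m. \<forall>i<n. max (antidiagonal n m i) (antidiagonal n m (Suc i)) \<le> V (Suc i)"
  let ?B = "{m. m \<in> displacements n k \<and> ?ok m}"
  define cut where "cut m = (\<lambda>i j. if i + j \<le> n then m i j else 0)" for m :: "nat \<Rightarrow> nat \<Rightarrow> nat"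
  define ext where "ext m = (\<lambda>i j. if i + j = Suc n then V i else m i j)" for m :: "nat \<Rightarrow> nat \<Rightarrow> nat"
  have V0: "V 0 = 0" "V (Suc n) = 0" "\<And>i. V i \<le> k"
    using V by (auto simp: vectors_def intro: vectors_bounded[OF V])
  have cut: "cut m \<in> ?B" "ext (cut m) = m" if "m \<in> ?A" for m
  proof -
    have m: "m \<in> displacements (Suc n) k" and a: "antidiagonal (Suc n) m = V" using that by auto
    have "cut m \<in> displacements n k"
      using m by (auto simp: displacements_def cut_def barrier_def triangle_def)
    moreover have "?ok (cut m)"
    proof (intro allI impI)
      fix i assume i: "i < n"
      then have "(Suc i, n - i) \<in> triangle (Suc n)" by (auto simp: triangle_def)
      then have "barrier m (Suc i) (n - i) \<le> m (Suc i) (n - i)" using m by (auto simp: displacements_def)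
      moreover have "m (Suc i) (n - i) = V (Suc i)" using a by (auto simp: antidiagonal_def)
      moreover have "n - i - 1 = n - Suc i" by simp
      ultimately show "max (antidiagonal n (cut m) i) (antidiagonal n (cut m) (Suc i)) \<le> V (Suc i)"
        using i by (auto simp: barrier_def antidiagonal_def cut_def)
    qed
    ultimately show "cut m \<in> ?B" by simp
    have "m i j = V i" if "i + j = Suc n" for i j
    proof -
      have "j = Suc n - i" using that by simp
      then show ?thesis using a by (auto simp: antidiagonal_def)
    qed
    moreover have "m i j = 0" if "i + j > Suc n" for i j
      using m that by (auto simp: displacements_def triangle_def)
    ultimately show "ext (cut m) = m" by (auto simp: ext_def cut_def fun_eq_iff)
  qed
  have ext: "ext m \<in> ?A" "cut (ext m) = m" if "m \<in> ?B" for m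
  proof -
    have m: "m \<in> displacements n k" and ok: "?ok m" using that by auto
    have z: "m i j = 0" if "i + j > n" for i j
      using m that by (auto simp: displacements_def triangle_def)
    have "barrier (ext m) i j \<le> ext m i j \<and> ext m i j \<le> k" if t: "(i, j) \<in> triangle (Suc n)" for i j
    proof (cases "i + j = Suc n")
      case True
      then have i: "i - 1 < n" "Suc (i - 1) = i" "n - (i - 1) = j" "n - i = j - 1"
        using t by (auto simp: triangle_def)
      have "max (antidiagonal n m (i - 1)) (antidiagonal n m (Suc (i - 1))) \<le> V (Suc (i - 1))"
        using ok i(1) by blast
      then have "max (m (i - 1) j) (m i (j - 1)) \<le> V i"
        unfolding antidiagonal_def i(2-4) .
      then show ?thesis using True t V0(3) by (auto simp: ext_def barrier_def triangle_def)
    next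
      case False
      then show ?thesis using t m by (auto simp: ext_def displacements_def barrier_def triangle_def)
    qed
    moreover have "ext m i j = 0" if t: "(i, j) \<notin> triangle (Suc n)" for i j
      using t V0 m by (cases "i + j = Suc n") (auto simp: ext_def triangle_def displacements_def not_le)
    ultimately have "ext m \<in> displacements (Suc n) k" by (auto simp: displacements_def)
    moreover have "antidiagonal (Suc n) (ext m) i = V i" for i
      using V by (cases "i \<le> Suc n") (auto simp: antidiagonal_def ext_def vectors_def z)
    ultimately show "ext m \<in> ?A" by auto
    show "cut (ext m) = m" using z by (auto simp: ext_def cut_def fun_eq_iff)
  qed
  have wt: "w ^ excess (Suc n) (ext m) = w ^ excess n m
        * (\<Prod>i<n. growth w (antidiagonal n m i) (antidiagonal n m (Suc i)) (V (Suc i)))"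
    if m: "m \<in> ?B" for m
  proof -
    have e: "excess n (ext m) = excess n m"
      unfolding excess_def by (rule sum.cong) (auto simp: ext_def triangle_def barrier_def)
    have a: "antidiagonal n (ext m) i = antidiagonal n m i" if "i \<le> n" for i
      using that by (auto simp: antidiagonal_def ext_def)
    have "excess (Suc n) (ext m) = excess n m
        + (\<Sum>i<n. V (Suc i) - max (antidiagonal n m i) (antidiagonal n m (Suc i)))"
      unfolding excess_Suc e
    proof (intro arg_cong2[of _ _ _ _ "(+)"] refl sum.cong)
      fix i assume "i \<in> {..<n}"
      then have "ext m (Suc i) (n - i) = V (Suc i)" "i \<le> n" "Suc i \<le> n"
        by (auto simp: ext_def)
      then show "ext m (Suc i) (n - i) - max (antidiagonal n (ext m) i) (antidiagonal n (ext m) (Suc i))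
          = V (Suc i) - max (antidiagonal n m i) (antidiagonal n m (Suc i))"
        by (simp only: a)
    qed
    then show ?thesis using m by (simp add: power_add power_sum growth_def)
  qed
  have "(\<Sum>m\<in>displacements n k. w ^ excess n m
        * (\<Prod>i<n. growth w (antidiagonal n m i) (antidiagonal n m (Suc i)) (V (Suc i))))
    = (\<Sum>m\<in>?B. w ^ excess n m
        * (\<Prod>i<n. growth w (antidiagonal n m i) (antidiagonal n m (Suc i)) (V (Suc i))))"
  proof (rule sum.mono_neutral_right)
    show "\<forall>m\<in>displacements n k - ?B. w ^ excess n m
        * (\<Prod>i<n. growth w (antidiagonal n m i) (antidiagonal n m (Suc i)) (V (Suc i))) = 0"
    proof
      fix m assume "m \<in> displacements n k - ?B"
      then obtain i where "i < n" "\<not> max (antidiagonal n m i) (antidiagonal n m (Suc i)) \<le> V (Suc i)"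
        by auto
      then have "(\<Prod>i<n. growth w (antidiagonal n m i) (antidiagonal n m (Suc i)) (V (Suc i))) = 0"
        by (intro prod_zero) (auto simp: growth_def intro!: bexI[of _ i])
      then show "w ^ excess n m
        * (\<Prod>i<n. growth w (antidiagonal n m i) (antidiagonal n m (Suc i)) (V (Suc i))) = 0" by simp
    qed
  qed auto
  also have "\<dots> = (\<Sum>m\<in>?A. w ^ excess (Suc n) m)"
    by (rule sum.reindex_bij_witness[of _ cut ext]) (use cut ext wt in auto)
  finally show ?thesis by simp
qed

text \<open>
  The same recursion on the side of partitions. Writing each transfer weight as a sum over the
  partition between its two arguments introduces a family \<open>M\<close> one antidiagonal below. For fixed \<open>M\<close>
  the partitions in \<open>L\<close> are independent, and the local growth rule sums each of them.
\<close>

lemma families_last_antidiagonal: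
  fixes w :: "'a::comm_ring_1"
  assumes V: "V \<in> vectors k (Suc n)" and n: "n \<ge> 1"
  shows "(\<Sum>L | L \<in> families k (Suc n) \<and> (\<lambda>i. L i 0) = V. \<Prod>i<Suc n. transfer_weight w (L i) (L (Suc i)))
    = (\<Sum>M\<in>families k n. (\<Prod>i<n. transfer_weight w (M i) (M (Suc i)))
        * (\<Prod>i<n. growth w (M i 0) (M (Suc i) 0) (V (Suc i))))"
proof -
  let ?F = "{L. L \<in> families k (Suc n) \<and> (\<lambda>i. L i 0) = V}"
  define B where "B i = (if i \<in> {1..<n} then parts k i else {\<lambda>_. 0})" for i
  have fam_n: "{M. (\<forall>i\<in>{..<Suc n}. M i \<in> B i) \<and> (\<forall>i. i \<notin> {..<Suc n} \<longrightarrow> M i = (\<lambda>_. 0))} = families k n"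
  proof -
    have "M i = (\<lambda>_. 0) \<longleftrightarrow> M i \<in> B i" if "i \<notin> {..<Suc n}" for M :: "nat \<Rightarrow> nat \<Rightarrow> nat" and i
      using that by (simp add: B_def)
    then have "{M. (\<forall>i\<in>{..<Suc n}. M i \<in> B i) \<and> (\<forall>i. i \<notin> {..<Suc n} \<longrightarrow> M i = (\<lambda>_. 0))}
        = {M. \<forall>i. M i \<in> B i}"
      by blast
    also have "\<dots> = families k n"
    proof -
      have "M i \<in> B i \<longleftrightarrow> (i \<in> {1..<n} \<longrightarrow> M i \<in> parts k i) \<and> (i \<notin> {1..<n} \<longrightarrow> M i = (\<lambda>_. 0))"
        for M i by (cases "i \<in> {1..<n}") (auto simp: B_def)
      then show ?thesis unfolding families_def by blast
    qed
    finally show ?thesis .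
  qed
  have expand: "(\<Prod>i<Suc n. transfer_weight w (L i) (L (Suc i)))
      = (\<Sum>M\<in>families k n. \<Prod>i<Suc n. below_weight w (M i) (L i) (L (Suc i)))"
    if L: "L \<in> ?F" for L
  proof -
    have LF: "L \<in> families k (Suc n)" using L by simp
    have "transfer_weight w (L i) (L (Suc i)) = (\<Sum>\<kappa>\<in>B i. below_weight w \<kappa> (L i) (L (Suc i)))"
      if i: "i \<in> {..<Suc n}" for i
    proof (rule transfer_weight_eq)
      fix \<kappa> assume \<kappa>: "\<kappa> \<prec> L i" "\<kappa> \<prec> L (Suc i)"
      consider "i = 0" | "i = n" | "i \<in> {1..<n}" using i by fastforce
      then show "\<kappa> \<in> B i"
      proof cases
        case 1
        then show ?thesis using LF \<kappa>(1) by (simp add: families_def B_def)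
      next
        case 2
        then show ?thesis using LF \<kappa>(2) by (simp add: families_def B_def)
      next
        case 3
        then show ?thesis using interlaces_parts[OF \<kappa>(1) families_parts[OF LF]] by (simp add: B_def)
      qed
    qed (simp add: B_def)
    then have "(\<Prod>i<Suc n. transfer_weight w (L i) (L (Suc i)))
        = (\<Prod>i\<in>{..<Suc n}. \<Sum>\<kappa>\<in>B i. below_weight w \<kappa> (L i) (L (Suc i)))"
      by (intro prod.cong) auto
    also have "\<dots> = (\<Sum>M\<in>families k n. \<Prod>i<Suc n. below_weight w (M i) (L i) (L (Suc i)))"
      unfolding fam_n[symmetric] by (rule prod_sum_functions) (auto simp: B_def)
    finally show ?thesis .
  qed
  \<comment> \<open>The weight is regrouped so that each factor involves a single member of the outer family.\<close>
  define q where "q \<mu> \<nu> \<rho> = (if \<mu> \<prec> \<rho> \<and> \<nu> \<prec> \<rho> then w ^ (weight \<rho> - weight \<mu>) else 0)" for \<mu> \<nu> \<rho>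
  have regroup: "(\<Prod>i<Suc n. below_weight w (M i) (L i) (L (Suc i)))
      = (\<Prod>i<n. q (M i) (M (Suc i)) (L (Suc i)))"
    if L: "L \<in> ?F" and M: "M \<in> families k n" for L M
  proof -
    define h where "h \<kappa> \<mu> = (if \<kappa> \<prec> \<mu> then 1 else 0 :: 'a)" for \<kappa> \<mu>
    define u where "u \<kappa> \<nu> = (if \<kappa> \<prec> \<nu> then w ^ (weight \<nu> - weight \<kappa>) else 0)" for \<kappa> \<nu>
    have z: "M 0 = (\<lambda>_. 0)" "L 0 = (\<lambda>_. 0)" "M n = (\<lambda>_. 0)" "L (Suc n) = (\<lambda>_. 0)"
      using L M by (auto simp: families_def)
    have "(\<Prod>i<Suc n. below_weight w (M i) (L i) (L (Suc i)))
        = (\<Prod>i<Suc n. h (M i) (L i)) * (\<Prod>i<Suc n. u (M i) (L (Suc i)))"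
      unfolding prod.distrib[symmetric]
      by (intro prod.cong) (auto simp: below_weight_def h_def u_def)
    also have "(\<Prod>i<Suc n. h (M i) (L i)) = (\<Prod>i<n. h (M (Suc i)) (L (Suc i)))"
      by (subst prod.lessThan_Suc_shift) (simp add: z h_def)
    also have "(\<Prod>i<Suc n. u (M i) (L (Suc i))) = (\<Prod>i<n. u (M i) (L (Suc i)))"
      by (simp add: z u_def)
    also have "(\<Prod>i<n. h (M (Suc i)) (L (Suc i))) * (\<Prod>i<n. u (M i) (L (Suc i)))
        = (\<Prod>i<n. q (M i) (M (Suc i)) (L (Suc i)))"
      unfolding prod.distrib[symmetric] by (intro prod.cong) (auto simp: q_def h_def u_def)
    finally show ?thesis .
  qed
  have inner: "(\<Sum>L\<in>?F. \<Prod>i<n. q (M i) (M (Suc i)) (L (Suc i)))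
      = (\<Prod>i<n. growth w (M i 0) (M (Suc i) 0) (V (Suc i)) * transfer_weight w (M i) (M (Suc i)))"
    if M: "M \<in> families k n" for M
  proof -
    let ?C = "\<lambda>i. {\<rho> \<in> parts k i. \<rho> 0 = V i}"
    have F: "?F = {L. (\<forall>i\<in>{1..n}. L i \<in> ?C i) \<and> (\<forall>i. i \<notin> {1..n} \<longrightarrow> L i = (\<lambda>_. 0))}"
    proof -
      have "((\<lambda>i. L i 0) = V) = (\<forall>i\<in>{1..n}. L i 0 = V i)" if "\<forall>i. i \<notin> {1..n} \<longrightarrow> L i = (\<lambda>_. 0)" for L
      proof
        assume r: "\<forall>i\<in>{1..n}. L i 0 = V i"
        have "L i 0 = V i" for i
          using r V that by (cases "i \<in> {1..n}") (auto simp: vectors_def)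
        then show "(\<lambda>i. L i 0) = V" by blast
      qed auto
      then show ?thesis by (auto simp: families_def less_Suc_eq_le)
    qed
    have "(\<Sum>L\<in>?F. \<Prod>i<n. q (M i) (M (Suc i)) (L (Suc i)))
        = (\<Sum>L\<in>?F. \<Prod>i\<in>{1..n}. q (M (i - 1)) (M i) (L i))"
      by (simp add: prod.atLeast1_atMost_eq)
    also have "\<dots> = (\<Prod>i\<in>{1..n}. \<Sum>\<rho>\<in>?C i. q (M (i - 1)) (M i) \<rho>)"
      unfolding F by (rule prod_sum_functions[symmetric]) auto
    also have "\<dots> = (\<Prod>i<n. \<Sum>\<rho>\<in>?C (Suc i). q (M i) (M (Suc i)) \<rho>)"
      by (simp add: prod.atLeast1_atMost_eq)
    also have "\<dots> = (\<Prod>i<n. growth w (M i 0) (M (Suc i) 0) (V (Suc i)) * transfer_weight w (M i) (M (Suc i)))"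
    proof (rule prod.cong[OF refl])
      fix i assume "i \<in> {..<n}"
      then have "V (Suc i) \<le> k" using V by (auto simp: vectors_def)
      from local_growth_rule[OF families_parts[OF M] families_parts[OF M] this, of w]
      show "(\<Sum>\<rho>\<in>?C (Suc i). q (M i) (M (Suc i)) \<rho>)
          = growth w (M i 0) (M (Suc i) 0) (V (Suc i)) * transfer_weight w (M i) (M (Suc i))"
        unfolding q_def by (subst sum.inter_filter[symmetric]) (auto simp: conj_ac)
    qed
    finally show ?thesis .
  qed
  have "(\<Sum>L\<in>?F. \<Prod>i<Suc n. transfer_weight w (L i) (L (Suc i)))
      = (\<Sum>L\<in>?F. \<Sum>M\<in>families k n. \<Prod>i<n. q (M i) (M (Suc i)) (L (Suc i)))"
    by (rule sum.cong[OF refl]) (subst expand, assumption, intro sum.cong refl regroup)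
  also have "\<dots> = (\<Sum>M\<in>families k n. \<Sum>L\<in>?F. \<Prod>i<n. q (M i) (M (Suc i)) (L (Suc i)))"
    by (rule sum.swap)
  also have "\<dots> = (\<Sum>M\<in>families k n. (\<Prod>i<n. transfer_weight w (M i) (M (Suc i)))
        * (\<Prod>i<n. growth w (M i 0) (M (Suc i) 0) (V (Suc i))))"
    by (intro sum.cong refl) (simp add: inner prod.distrib mult.commute)
  finally show ?thesis .
qed

text \<open>
  The enumerative form of the Robinson-Schensted-Knuth correspondence on a staircase. The test
  function \<open>F\<close> records that last passage times on the antidiagonal become first parts; it is needed
  for the induction, where \<open>F\<close> is the product of the growth factors of the next antidiagonal.
\<close>

lemma displacements_families:
  fixes w :: "'a::comm_ring_1"
  assumes "n \<ge> 1"
  shows "(\<Sum>m\<in>displacements n k. w ^ excess n m * F (antidiagonal n m))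
    = (\<Sum>L\<in>families k n. (\<Prod>i<n. transfer_weight w (L i) (L (Suc i))) * F (\<lambda>i. L i 0))"
  using assms
proof (induction n arbitrary: F rule: dec_induct)
  case base
  have "displacements 1 k = {\<lambda>i j. 0}"
    by (auto simp: displacements_def triangle_def barrier_def fun_eq_iff)
  moreover have "families k 1 = {\<lambda>i j. 0}" by (auto simp: families_def)
  moreover have "transfer_weight w (\<lambda>_. 0) (\<lambda>_. 0) = 1" by (simp add: transfer_weight_def)
  ultimately show ?case by (simp add: excess_def triangle_def antidiagonal_def)
next
  case (step n)
  let ?m = "\<lambda>V. {m. m \<in> displacements (Suc n) k \<and> antidiagonal (Suc n) m = V}"
  let ?f = "\<lambda>V. {L. L \<in> families k (Suc n) \<and> (\<lambda>i. L i 0) = V}"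
  have main: "(\<Sum>m\<in>?m V. w ^ excess (Suc n) m) = (\<Sum>L\<in>?f V. \<Prod>i<Suc n. transfer_weight w (L i) (L (Suc i)))"
    if V: "V \<in> vectors k (Suc n)" for V
    unfolding displacements_last_antidiagonal[OF V] families_last_antidiagonal[OF V step.hyps(1)]
    by (rule step.IH)
  have "(\<Sum>m\<in>displacements (Suc n) k. w ^ excess (Suc n) m * F (antidiagonal (Suc n) m))
      = (\<Sum>V\<in>vectors k (Suc n). \<Sum>m\<in>?m V. w ^ excess (Suc n) m * F (antidiagonal (Suc n) m))"
    by (rule sum.group[symmetric]) (auto intro: antidiagonal_vectors)
  also have "\<dots> = (\<Sum>V\<in>vectors k (Suc n). (\<Sum>m\<in>?m V. w ^ excess (Suc n) m) * F V)"
    by (intro sum.cong refl) (auto simp: sum_distrib_right)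
  also have "\<dots> = (\<Sum>V\<in>vectors k (Suc n). (\<Sum>L\<in>?f V. \<Prod>i<Suc n. transfer_weight w (L i) (L (Suc i))) * F V)"
    by (intro sum.cong refl) (simp only: main)
  also have "\<dots> = (\<Sum>V\<in>vectors k (Suc n). \<Sum>L\<in>?f V. (\<Prod>i<Suc n. transfer_weight w (L i) (L (Suc i))) * F (\<lambda>i. L i 0))"
    by (intro sum.cong refl) (auto simp: sum_distrib_right)
  also have "\<dots> = (\<Sum>L\<in>families k (Suc n). (\<Prod>i<Suc n. transfer_weight w (L i) (L (Suc i))) * F (\<lambda>i. L i 0))"
    by (rule sum.group) (auto intro: families_first)
  finally show ?case .
qed

section \<open>Non-intersecting paths and determinants\<close>

definition bounded_partitions :: "nat \<Rightarrow> (nat \<Rightarrow> nat) set" where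
  "bounded_partitions k = {\<rho>. antimono \<rho> \<and> \<rho> 0 \<le> k \<and> (\<exists>N. \<forall>j\<ge>N. \<rho> j = 0)}"

text \<open>
  The conjugate partition.
\<close>

definition columns :: "(nat \<Rightarrow> nat) \<Rightarrow> nat \<Rightarrow> nat" where
  "columns \<rho> j = card {i. j < \<rho> i}"

lemma parts_bounded: "\<rho> \<in> parts k i \<Longrightarrow> \<rho> \<in> bounded_partitions k"
  by (auto simp: parts_def bounded_partitions_def)

lemma bounded_partitionsE:
  assumes "\<rho> \<in> bounded_partitions k" obtains i where "\<rho> \<in> parts k i"
  using assms by (auto simp: parts_def bounded_partitions_def)

lemma zero_bounded [simp]: "(\<lambda>_. 0) \<in> bounded_partitions k"
  by (rule parts_bounded[OF zero_in_parts])

lemma less_columns_iff: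
  assumes "\<rho> \<in> bounded_partitions k"
  shows "i < columns \<rho> j \<longleftrightarrow> j < \<rho> i"
proof -
  obtain N where N: "\<And>j. j \<ge> N \<Longrightarrow> \<rho> j = 0" using assms by (auto simp: bounded_partitions_def)
  define c where "c = (LEAST i. \<rho> i \<le> j)"
  have c: "\<rho> c \<le> j" unfolding c_def by (rule LeastI[of _ N]) (simp add: N)
  have "j < \<rho> i \<longleftrightarrow> i < c" for i
  proof
    assume "j < \<rho> i"
    moreover have "\<rho> i \<le> \<rho> c" if "c \<le> i"
      using assms that by (auto simp: bounded_partitions_def dest: antimonoD)
    ultimately show "i < c" using c by (meson leD le_trans not_le)
  next
    assume "i < c"
    then show "j < \<rho> i" using not_less_Least[of i "\<lambda>i. \<rho> i \<le> j"] by (simp add: c_def)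
  qed
  then have "{i. j < \<rho> i} = {..<c}" by auto
  then show ?thesis using \<open>\<And>i. (j < \<rho> i) = (i < c)\<close> by (simp add: columns_def)
qed

lemma columns_bounded_partition:
  assumes \<rho>: "\<rho> \<in> bounded_partitions k"
  shows "columns \<rho> \<in> bounded_partitions (columns \<rho> 0)" and "j \<ge> k \<Longrightarrow> columns \<rho> j = 0"
proof -
  have anti: "\<rho> i \<le> \<rho> 0" "\<rho> 0 \<le> k" for i using \<rho> by (auto simp: bounded_partitions_def antimonoD)
  then show z: "columns \<rho> j = 0" if "j \<ge> k" for j
    using less_columns_iff[OF \<rho>, of 0 j] that by auto
  have "antimono (columns \<rho>)"
  proof (rule antimonoI)
    fix a b :: nat assume "a \<le> b"
    then show "columns \<rho> b \<le> columns \<rho> a"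
      using less_columns_iff[OF \<rho>] by (meson le_less_trans not_le order_refl)
  qed
  then show "columns \<rho> \<in> bounded_partitions (columns \<rho> 0)"
    using z by (auto simp: bounded_partitions_def)
qed

lemma columns_columns:
  assumes \<rho>: "\<rho> \<in> bounded_partitions k" shows "columns (columns \<rho>) = \<rho>"
proof
  fix j
  have "i < columns (columns \<rho>) j \<longleftrightarrow> i < \<rho> j" for i
    using less_columns_iff[OF columns_bounded_partition(1)[OF \<rho>]] less_columns_iff[OF \<rho>] by simp
  then show "columns (columns \<rho>) j = \<rho> j" by (meson linorder_neqE_nat less_irrefl)
qed

lemma interlaces_columns:
  assumes \<kappa>: "\<kappa> \<in> bounded_partitions k" and \<mu>: "\<mu> \<in> bounded_partitions k"
  shows "\<kappa> \<prec> \<mu> \<longleftrightarrow> (\<forall>j<k. columns \<kappa> j \<le> columns \<mu> j \<and> columns \<mu> j \<le> Suc (columns \<kappa> j))"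
proof -
  note c\<kappa> = less_columns_iff[OF \<kappa>] and c\<mu> = less_columns_iff[OF \<mu>]
  have "\<kappa> \<prec> \<mu> \<longleftrightarrow> (\<forall>j. columns \<kappa> j \<le> columns \<mu> j \<and> columns \<mu> j \<le> Suc (columns \<kappa> j))"
  proof
    assume i: "\<kappa> \<prec> \<mu>"
    show "\<forall>j. columns \<kappa> j \<le> columns \<mu> j \<and> columns \<mu> j \<le> Suc (columns \<kappa> j)"
    proof (intro allI conjI)
      fix j
      show "columns \<kappa> j \<le> columns \<mu> j"
        using c\<kappa>[of "columns \<mu> j" j] c\<mu>[of "columns \<mu> j" j] i unfolding interlaces_def
        by (meson less_irrefl less_le_trans not_le)
      show "columns \<mu> j \<le> Suc (columns \<kappa> j)"
        using c\<kappa>[of "columns \<kappa> j" j] c\<mu>[of "Suc (columns \<kappa> j)" j] i unfolding interlaces_def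
        by (meson less_irrefl less_le_trans not_le)
    qed
  next
    assume c: "\<forall>j. columns \<kappa> j \<le> columns \<mu> j \<and> columns \<mu> j \<le> Suc (columns \<kappa> j)"
    show "\<kappa> \<prec> \<mu>" unfolding interlaces_def
    proof (intro allI conjI)
      fix i
      show "\<kappa> i \<le> \<mu> i"
        using c\<kappa>[of i "\<mu> i"] c\<mu>[of i "\<mu> i"] c by (meson less_irrefl less_le_trans not_le)
      show "\<mu> (Suc i) \<le> \<kappa> i"
        using c\<kappa>[of i "\<kappa> i"] c\<mu>[of "Suc i" "\<kappa> i"] c
        by (meson Suc_less_eq less_irrefl less_le_trans not_le)
    qed
  qed
  also have "\<dots> \<longleftrightarrow> (\<forall>j<k. columns \<kappa> j \<le> columns \<mu> j \<and> columns \<mu> j \<le> Suc (columns \<kappa> j))"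
    using columns_bounded_partition(2)[OF \<kappa>] columns_bounded_partition(2)[OF \<mu>]
    by (metis le0 not_less)
  finally show ?thesis .
qed

lemma weight_columns:
  assumes \<rho>: "\<rho> \<in> bounded_partitions k"
  shows "weight \<rho> = (\<Sum>j<k. columns \<rho> j)"
proof -
  obtain N where N: "\<And>j. j \<ge> N \<Longrightarrow> \<rho> j = 0" using \<rho> by (auto simp: bounded_partitions_def)
  have b: "\<rho> i \<le> k" for i
    using \<rho> antimonoD[of \<rho> 0 i] by (auto simp: bounded_partitions_def)
  have col: "columns \<rho> j \<le> N" for j
    using less_columns_iff[OF \<rho>, of N j] N[of N] by simp
  have "weight \<rho> = (\<Sum>i<N. \<rho> i)" by (rule weight_eq) (rule N)
  also have "\<dots> = (\<Sum>i<N. \<Sum>j<k. if j < \<rho> i then 1 else 0)"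
  proof (rule sum.cong[OF refl])
    fix i
    have "{..<k} \<inter> {j. j < \<rho> i} = {..<\<rho> i}" using b[of i] by auto
    then show "\<rho> i = (\<Sum>j<k. if j < \<rho> i then 1 else 0)" by (simp add: sum.If_cases)
  qed
  also have "\<dots> = (\<Sum>j<k. \<Sum>i<N. if i < columns \<rho> j then 1 else 0)"
    by (subst sum.swap) (simp add: less_columns_iff[OF \<rho>])
  also have "\<dots> = (\<Sum>j<k. columns \<rho> j)"
  proof (rule sum.cong[OF refl])
    fix j
    have "{..<N} \<inter> {i. i < columns \<rho> j} = {..<columns \<rho> j}" using col[of j] by auto
    then show "(\<Sum>i<N. if i < columns \<rho> j then 1 else 0) = columns \<rho> j" by (simp add: sum.If_cases)
  qed
  finally show ?thesis .
qed

text \<open>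
  Adding \<open>j\<close> to the increasing sequence of column lengths makes it strictly increasing; the
  positions are the heights of \<open>k\<close> non-intersecting paths, from bottom to top.
\<close>

definition position :: "nat \<Rightarrow> (nat \<Rightarrow> nat) \<Rightarrow> nat \<Rightarrow> nat" where
  "position k \<rho> j = columns \<rho> (k - 1 - j) + j"

definition of_positions :: "nat \<Rightarrow> (nat \<Rightarrow> nat) \<Rightarrow> nat \<Rightarrow> nat" where
  "of_positions k y = columns (\<lambda>j. if j < k then y (k - 1 - j) - (k - 1 - j) else 0)"

lemma position_strict_mono:
  assumes "\<rho> \<in> bounded_partitions k"
  shows "strict_mono_on {..<k} (position k \<rho>)"
proof (rule strict_mono_onI)
  fix a b assume "a \<in> {..<k}" "b \<in> {..<k}" "a < b"
  moreover have anti: "antimono (columns \<rho>)"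
    using columns_bounded_partition(1)[OF assms] by (simp add: bounded_partitions_def)
  ultimately have "columns \<rho> (k - 1 - a) \<le> columns \<rho> (k - 1 - b)"
    using antimonoD[OF anti, of "k - 1 - b" "k - 1 - a"] by simp
  then show "position k \<rho> a < position k \<rho> b" using \<open>a < b\<close> by (simp add: position_def)
qed

lemma strict_mono_on_ge:
  fixes y :: "nat \<Rightarrow> nat"
  assumes "strict_mono_on {..<k} y" "a \<le> b" "b < k"
  shows "y a + (b - a) \<le> y b"
  using assms(2,3)
proof (induction b rule: dec_induct)
  case (step b)
  then have "y b < y (Suc b)" using assms(1) by (auto simp: strict_mono_on_def)
  then show ?case using step by simp
qed simp

lemma of_positions:
  assumes y: "strict_mono_on {..<k} y"
  shows "of_positions k y \<in> bounded_partitions k"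
    and "j < k \<Longrightarrow> position k (of_positions k y) j = y j"
proof -
  let ?c = "\<lambda>j. if j < k then y (k - 1 - j) - (k - 1 - j) else 0"
  have "antimono ?c"
  proof (rule antimonoI)
    fix a b :: nat assume "a \<le> b"
    then show "?c b \<le> ?c a"
    proof (cases "b < k")
      case True
      then have "k - 1 - b \<le> k - 1 - a" "k - 1 - a < k" using \<open>a \<le> b\<close> by linarith+
      from strict_mono_on_ge[OF y this] show ?thesis using True \<open>a \<le> b\<close> by simp
    qed simp
  qed
  then have c: "?c \<in> bounded_partitions (?c 0)"
    unfolding bounded_partitions_def by (auto intro!: exI[of _ k])
  have "\<not> k < columns ?c 0" using less_columns_iff[OF c, of k 0] by simp
  then show "of_positions k y \<in> bounded_partitions k"
    using columns_bounded_partition(1)[OF c] by (auto simp: of_positions_def bounded_partitions_def)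
  show "position k (of_positions k y) j = y j" if "j < k"
  proof -
    have "columns (of_positions k y) = ?c"
      unfolding of_positions_def by (rule columns_columns[OF c])
    moreover have "j \<le> y j" using strict_mono_on_ge[OF y, of 0 j] that by simp
    ultimately show ?thesis using that by (simp add: position_def)
  qed
qed

lemma position_inject:
  assumes \<rho>: "\<rho> \<in> bounded_partitions k" and \<sigma>: "\<sigma> \<in> bounded_partitions k"
    and eq: "\<And>j. j < k \<Longrightarrow> position k \<rho> j = position k \<sigma> j"
  shows "\<rho> = \<sigma>"
proof -
  have "columns \<rho> j = columns \<sigma> j" for j
  proof (cases "j < k")
    case True
    then show ?thesis using eq[of "k - 1 - j"] by (simp add: position_def)
  qed (simp add: columns_bounded_partition(2)[OF \<rho>] columns_bounded_partition(2)[OF \<sigma>])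
  then have "columns (columns \<rho>) = columns (columns \<sigma>)" by presburger
  then show ?thesis using columns_columns \<rho> \<sigma> by simp
qed

lemma interlaces_position:
  assumes "\<kappa> \<in> bounded_partitions k" "\<mu> \<in> bounded_partitions k"
  shows "\<kappa> \<prec> \<mu> \<longleftrightarrow> (\<forall>j<k. position k \<kappa> j \<le> position k \<mu> j \<and> position k \<mu> j \<le> Suc (position k \<kappa> j))"
proof -
  have "(\<forall>j<k. P (k - 1 - j)) \<longleftrightarrow> (\<forall>j<k. P j)" for P
  proof (intro iffI allI impI)
    fix j assume "\<forall>j<k. P (k - 1 - j)" "j < k"
    moreover have "k - 1 - (k - 1 - j) = j" "k - 1 - j < k" using \<open>j < k\<close> by auto
    ultimately show "P j" by metis
  qed auto
  from this[of "\<lambda>j. columns \<kappa> j \<le> columns \<mu> j \<and> columns \<mu> j \<le> Suc (columns \<kappa> j)"]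
  show ?thesis unfolding interlaces_columns[OF assms] position_def by simp
qed

lemma weight_position:
  assumes "\<rho> \<in> bounded_partitions k"
  shows "weight \<rho> + (\<Sum>j<k. j) = (\<Sum>j<k. position k \<rho> j)"
  unfolding weight_columns[OF assms] position_def sum.distrib
  by (simp add: sum.nat_diff_reindex)

lemma position_zero: "position k (\<lambda>_. 0) j = j"
  by (simp add: position_def columns_def)

lemma det_zero_row:
  fixes A :: "'a::comm_ring_1 mat"
  assumes "A \<in> carrier_mat k k" "i < k" "\<And>r. r < k \<Longrightarrow> A $$ (i, r) = 0"
  shows "det A = 0"
  unfolding det_def'[OF assms(1)]
proof (rule sum.neutral, rule ballI)
  fix p assume "p \<in> {p. p permutes {0..<k}}"
  then have "p i < k" using assms(2) by (metis atLeastLessThan_iff le0 mem_Collect_eq permutes_in_image)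
  then have "(\<Prod>i = 0..<k. A $$ (i, p i)) = 0"
    using assms by (intro prod_zero bexI[of _ i]) auto
  then show "signof p * (\<Prod>i = 0..<k. A $$ (i, p i)) = 0" by simp
qed

text \<open>
  Multilinearity of the determinant in all rows at once; \<open>S\<close> collects the rows that take the
  upper choice.
\<close>

lemma det_row_expansion:
  fixes h :: "nat \<Rightarrow> nat \<Rightarrow> 'a::comm_ring_1"
  shows "det (mat k k (\<lambda>(j, r). u * h r (x j) + v * h r (Suc (x j))))
    = (\<Sum>S\<in>Pow {..<k}. u ^ (k - card S) * v ^ card S
        * det (mat k k (\<lambda>(j, r). h r (x j + of_bool (j \<in> S)))))"
proof -
  let ?P = "{p. p permutes {0..<k}}"
  have pk: "p j < k" if "p \<in> ?P" "j < k" for p j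
    using that by (metis atLeastLessThan_iff le0 mem_Collect_eq permutes_in_image)
  have exp: "(\<Prod>j = 0..<k. u * h (p j) (x j) + v * h (p j) (Suc (x j)))
      = (\<Sum>S\<in>Pow {..<k}. u ^ (k - card S) * v ^ card S * (\<Prod>j = 0..<k. h (p j) (x j + of_bool (j \<in> S))))"
    for p :: "nat \<Rightarrow> nat"
  proof -
    have "(\<Prod>j = 0..<k. u * h (p j) (x j) + v * h (p j) (Suc (x j)))
        = (\<Prod>j\<in>{..<k}. v * h (p j) (Suc (x j)) + u * h (p j) (x j))"
      by (intro prod.cong) (auto simp: add.commute)
    also have "\<dots> = (\<Sum>S\<in>Pow {..<k}. (\<Prod>j\<in>S. v * h (p j) (Suc (x j))) * (\<Prod>j\<in>{..<k} - S. u * h (p j) (x j)))"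
      by (rule prod_add) simp
    also have "\<dots> = (\<Sum>S\<in>Pow {..<k}. u ^ (k - card S) * v ^ card S * (\<Prod>j = 0..<k. h (p j) (x j + of_bool (j \<in> S))))"
    proof (rule sum.cong[OF refl])
      fix S assume "S \<in> Pow {..<k}"
      then have S: "S \<subseteq> {..<k}" "finite S" by (auto intro: finite_subset)
      have "(\<Prod>j = 0..<k. h (p j) (x j + of_bool (j \<in> S))) = (\<Prod>j\<in>{..<k}. h (p j) (x j + of_bool (j \<in> S)))"
        by (intro prod.cong) auto
      also have "\<dots> = (\<Prod>j\<in>{..<k} - S. h (p j) (x j + of_bool (j \<in> S))) * (\<Prod>j\<in>S. h (p j) (x j + of_bool (j \<in> S)))"
        by (rule prod.subset_diff) (use S in auto)
      also have "\<dots> = (\<Prod>j\<in>{..<k} - S. h (p j) (x j)) * (\<Prod>j\<in>S. h (p j) (Suc (x j)))"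
        by (intro arg_cong2[of _ _ _ _ "(*)"] prod.cong) auto
      finally have *: "(\<Prod>j = 0..<k. h (p j) (x j + of_bool (j \<in> S)))
          = (\<Prod>j\<in>{..<k} - S. h (p j) (x j)) * (\<Prod>j\<in>S. h (p j) (Suc (x j)))" .
      have "card ({..<k} - S) = k - card S" using S by (simp add: card_Diff_subset)
      then show "(\<Prod>j\<in>S. v * h (p j) (Suc (x j))) * (\<Prod>j\<in>{..<k} - S. u * h (p j) (x j))
          = u ^ (k - card S) * v ^ card S * (\<Prod>j = 0..<k. h (p j) (x j + of_bool (j \<in> S)))"
        unfolding * by (simp add: prod.distrib mult_ac)
    qed
    finally show ?thesis .
  qed
  have "det (mat k k (\<lambda>(j, r). u * h r (x j) + v * h r (Suc (x j))))
      = (\<Sum>p\<in>?P. signof p * (\<Prod>j = 0..<k. u * h (p j) (x j) + v * h (p j) (Suc (x j))))"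
    by (subst det_def'[of _ k]) (auto intro!: sum.cong arg_cong2[of _ _ _ _ "(*)"] prod.cong simp: pk)
  also have "\<dots> = (\<Sum>p\<in>?P. \<Sum>S\<in>Pow {..<k}. u ^ (k - card S) * v ^ card S
      * (signof p * (\<Prod>j = 0..<k. h (p j) (x j + of_bool (j \<in> S)))))"
    by (simp add: exp sum_distrib_left mult_ac)
  also have "\<dots> = (\<Sum>S\<in>Pow {..<k}. u ^ (k - card S) * v ^ card S
      * (\<Sum>p\<in>?P. signof p * (\<Prod>j = 0..<k. h (p j) (x j + of_bool (j \<in> S)))))"
    by (subst sum.swap) (simp add: sum_distrib_left)
  also have "\<dots> = (\<Sum>S\<in>Pow {..<k}. u ^ (k - card S) * v ^ card S
        * det (mat k k (\<lambda>(j, r). h r (x j + of_bool (j \<in> S)))))"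
    by (intro sum.cong refl arg_cong2[of _ _ _ _ "(*)"], subst det_def'[of _ k])
      (auto intro!: sum.cong arg_cong2[of _ _ _ _ "(*)"] prod.cong simp: pk)
  finally show ?thesis .
qed

text \<open>
  Two paths that start at different heights and move up by at most one keep their order unless
  they collide, and a collision produces two equal rows.
\<close>

lemma det_row_expansion_strict:
  fixes h :: "nat \<Rightarrow> nat \<Rightarrow> 'a::comm_ring_1"
  assumes x: "strict_mono_on {..<k} x"
  shows "det (mat k k (\<lambda>(j, r). u * h r (x j) + v * h r (Suc (x j))))
    = (\<Sum>S | S \<subseteq> {..<k} \<and> strict_mono_on {..<k} (\<lambda>j. x j + of_bool (j \<in> S)).
        u ^ (k - card S) * v ^ card S * det (mat k k (\<lambda>(j, r). h r (x j + of_bool (j \<in> S)))))"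
  unfolding det_row_expansion
proof (rule sum.mono_neutral_right)
  show "\<forall>S\<in>Pow {..<k} - {S. S \<subseteq> {..<k} \<and> strict_mono_on {..<k} (\<lambda>j. x j + of_bool (j \<in> S))}.
    u ^ (k - card S) * v ^ card S * det (mat k k (\<lambda>(j, r). h r (x j + of_bool (j \<in> S)))) = 0"
  proof
    fix S assume "S \<in> Pow {..<k} - {S. S \<subseteq> {..<k} \<and> strict_mono_on {..<k} (\<lambda>j. x j + of_bool (j \<in> S))}"
    then obtain a b where ab: "a < k" "b < k" "a < b"
      "\<not> x a + of_bool (a \<in> S) < x b + of_bool (b \<in> S)"
      by (auto simp: strict_mono_on_def)
    moreover have "x a < x b" using x ab by (auto simp: strict_mono_on_def)
    ultimately have eq: "x a + of_bool (a \<in> S) = x b + of_bool (b \<in> S)"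
      by (cases "a \<in> S"; cases "b \<in> S") auto
    have "det (mat k k (\<lambda>(j, r). h r (x j + of_bool (j \<in> S)))) = 0"
      by (rule det_identical_rows[of _ k a b]) (use ab eq in \<open>auto intro!: eq_vecI\<close>)
    then show "u ^ (k - card S) * v ^ card S * det (mat k k (\<lambda>(j, r). h r (x j + of_bool (j \<in> S)))) = 0"
      by simp
  qed
qed auto

text \<open>
  The Lindstroem-Gessel-Viennot determinant for \<open>k\<close> paths ending at the positions of \<open>\<rho>\<close>, when
  \<open>f r x\<close> is the weight of all paths from the \<open>r\<close>-th start to height \<open>x\<close>.
\<close>

definition minor :: "nat \<Rightarrow> (nat \<Rightarrow> nat \<Rightarrow> 'a::comm_ring_1) \<Rightarrow> (nat \<Rightarrow> nat) \<Rightarrow> 'a" where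
  "minor k f \<rho> = det (mat k k (\<lambda>(j, r). f r (position k \<rho> j)))"

lemma minor_add_strip:
  assumes \<kappa>: "\<kappa> \<in> bounded_partitions k"
  shows "minor k (\<lambda>r x. f r x + f r (Suc x)) \<kappa>
    = (\<Sum>\<mu> | \<mu> \<in> bounded_partitions k \<and> \<kappa> \<prec> \<mu>. minor k f \<mu>)"
proof -
  let ?x = "position k \<kappa>"
  let ?y = "\<lambda>S j. ?x j + of_bool (j \<in> S)"
  let ?G = "{S. S \<subseteq> {..<k} \<and> strict_mono_on {..<k} (?y S)}"
  let ?U = "{\<mu>. \<mu> \<in> bounded_partitions k \<and> \<kappa> \<prec> \<mu>}"
  let ?i = "\<lambda>S. of_positions k (?y S)"
  let ?j = "\<lambda>\<mu>. {j. j < k \<and> position k \<mu> j = Suc (?x j)}"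
  have "minor k (\<lambda>r x. f r x + f r (Suc x)) \<kappa> = (\<Sum>S\<in>?G. det (mat k k (\<lambda>(j, r). f r (?y S j))))"
    unfolding minor_def
    using det_row_expansion_strict[OF position_strict_mono[OF \<kappa>], of 1 f 1] by simp
  also have "\<dots> = (\<Sum>\<mu>\<in>?U. minor k f \<mu>)"
  proof (rule sum.reindex_bij_witness[of _ ?j ?i])
    fix S assume "S \<in> ?G"
    then have S: "S \<subseteq> {..<k}" and y: "strict_mono_on {..<k} (?y S)" by auto
    note p = of_positions[OF y]
    show "?j (?i S) = S"
    proof -
      have "position k (?i S) j = Suc (?x j) \<longleftrightarrow> j \<in> S" if "j < k" for j
        using p(2)[OF that] by (cases "j \<in> S") auto
      then show ?thesis using S by auto
    qed
    show "?i S \<in> ?U" using p interlaces_position[OF \<kappa> p(1)] by auto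
    show "minor k f (?i S) = det (mat k k (\<lambda>(j, r). f r (?y S j)))"
      unfolding minor_def by (intro arg_cong[of _ _ det] eq_matI) (auto simp: p(2))
  next
    fix \<mu> assume "\<mu> \<in> ?U"
    then have \<mu>: "\<mu> \<in> bounded_partitions k" and i: "\<kappa> \<prec> \<mu>" by auto
    have eq: "?y (?j \<mu>) j = position k \<mu> j" if "j < k" for j
      using i that unfolding interlaces_position[OF \<kappa> \<mu>] by (auto simp: le_Suc_eq)
    have s: "strict_mono_on {..<k} (?y (?j \<mu>))"
      using position_strict_mono[OF \<mu>] eq by (simp add: strict_mono_on_def)
    then show "?j \<mu> \<in> ?G" by auto
    show "?i (?j \<mu>) = \<mu>"
      by (rule position_inject[OF of_positions(1)[OF s] \<mu>]) (simp only: of_positions(2)[OF s] eq)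
  qed
  finally show ?thesis .
qed

text \<open>
  Here a path at height \<open>0\<close> cannot move down. Shifting heights by one and letting the new height \<open>0\<close>
  have weight \<open>0\<close> reduces this to \<open>det_row_expansion_strict\<close>: a path that would go below
  the ground gives a zero row.
\<close>

lemma minor_remove_strip:
  assumes \<nu>: "\<nu> \<in> bounded_partitions k"
  shows "minor k (\<lambda>r x. f r x + (if x = 0 then 0 else w * f r (x - 1))) \<nu>
    = (\<Sum>\<kappa> | \<kappa> \<prec> \<nu>. w ^ (weight \<nu> - weight \<kappa>) * minor k f \<kappa>)"
proof -
  let ?x = "position k \<nu>"
  let ?y = "\<lambda>S j. ?x j + of_bool (j \<in> S)"
  let ?G = "{S. S \<subseteq> {..<k} \<and> strict_mono_on {..<k} (?y S)}"
  let ?P = "{S. S \<subseteq> {..<k} \<and> strict_mono_on {..<k} (?y S) \<and> (\<forall>j<k. ?y S j \<noteq> 0)}"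
  let ?U = "{\<kappa>. \<kappa> \<prec> \<nu>}"
  let ?i = "\<lambda>S. of_positions k (\<lambda>j. ?y S j - 1)"
  let ?j = "\<lambda>\<kappa>. {j. j < k \<and> position k \<kappa> j = ?x j}"
  define h where "h r x = (case x of 0 \<Rightarrow> 0 | Suc x \<Rightarrow> f r x)" for r x
  have h: "f r x + (if x = 0 then 0 else w * f r (x - 1)) = w * h r x + 1 * h r (Suc x)" for r x
    by (cases x) (auto simp: h_def)
  have U: "\<kappa> \<in> bounded_partitions k" if "\<kappa> \<prec> \<nu>" for \<kappa>
    using \<nu> by (auto elim!: bounded_partitionsE intro: parts_bounded interlaces_parts[OF that])
  have "minor k (\<lambda>r x. f r x + (if x = 0 then 0 else w * f r (x - 1))) \<nu>
      = (\<Sum>S\<in>?G. w ^ (k - card S) * det (mat k k (\<lambda>(j, r). h r (?y S j))))"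
    unfolding minor_def h
    by (subst det_row_expansion_strict[OF position_strict_mono[OF \<nu>]]) simp
  also have "\<dots> = (\<Sum>S\<in>?P. w ^ (k - card S) * det (mat k k (\<lambda>(j, r). h r (?y S j))))"
  proof (rule sum.mono_neutral_right)
    have zero: "det (mat k k (\<lambda>(j, r). h r (?y S j))) = 0" if "j < k" "?y S j = 0" for S j
      by (rule det_zero_row[of _ k j]) (use that in \<open>auto simp: h_def\<close>)
    show "\<forall>S\<in>?G - ?P. w ^ (k - card S) * det (mat k k (\<lambda>(j, r). h r (?y S j))) = 0"
    proof
      fix S assume "S \<in> ?G - ?P"
      then have "\<not> (\<forall>j<k. ?y S j \<noteq> 0)" by (simp only: Diff_iff mem_Collect_eq) argo
      then obtain j where "j < k" "?y S j = 0" by metis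
      from zero[OF this] show "w ^ (k - card S) * det (mat k k (\<lambda>(j, r). h r (?y S j))) = 0"
        by (simp only: mult_zero_right)
    qed
  qed (auto intro: finite_subset[of _ "Pow {..<k}"])
  also have "\<dots> = (\<Sum>\<kappa>\<in>?U. w ^ (weight \<nu> - weight \<kappa>) * minor k f \<kappa>)"
  proof (rule sum.reindex_bij_witness[of _ ?j ?i])
    fix S assume "S \<in> ?P"
    then have S: "S \<subseteq> {..<k}" and y: "strict_mono_on {..<k} (?y S)" and pos: "\<And>j. j < k \<Longrightarrow> ?y S j \<noteq> 0"
      by auto
    have y': "strict_mono_on {..<k} (\<lambda>j. ?y S j - 1)"
    proof (rule strict_mono_onI)
      fix a b assume ab: "a \<in> {..<k}" "b \<in> {..<k}" "a < b"
      then have "?y S a < ?y S b" using y by (auto simp: strict_mono_on_def)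
      moreover have "a < k" using ab by simp
      note pos[OF this]
      ultimately show "?y S a - 1 < ?y S b - 1" by linarith
    qed
    note p = of_positions[OF y']
    have eq: "Suc (position k (?i S) j) = ?y S j" if "j < k" for j
      using p(2)[OF that] pos[OF that] by simp
    show "?j (?i S) = S"
    proof -
      have "position k (?i S) j = ?x j \<longleftrightarrow> j \<in> S" if "j < k" for j
        using eq[OF that] by (cases "j \<in> S") auto
      then show ?thesis using S by auto
    qed
    have "?i S \<prec> \<nu>"
      unfolding interlaces_position[OF p(1) \<nu>]
    proof (intro allI impI)
      fix j assume "j < k"
      from eq[OF this] show "position k (?i S) j \<le> ?x j \<and> ?x j \<le> Suc (position k (?i S) j)"
        by (cases "j \<in> S") auto
    qed
    then show "?i S \<in> ?U" by simp
    \<comment> \<open>The paths outside \<open>S\<close> move, so the number of removed boxes is \<open>k - card S\<close>.\<close>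
    have "(\<Sum>j<k. position k (?i S) j) + k = (\<Sum>j<k. Suc (position k (?i S) j))"
      by (simp add: sum_Suc)
    also have "\<dots> = (\<Sum>j<k. ?y S j)" by (rule sum.cong[OF refl], rule eq) simp
    also have "\<dots> = (\<Sum>j<k. ?x j) + card S"
      using S by (simp add: sum.distrib of_bool_def sum.If_cases Int_absorb1)
    finally have "weight (?i S) + k = weight \<nu> + card S"
      using weight_position[OF p(1)] weight_position[OF \<nu>] by linarith
    moreover have "card S \<le> k" using card_mono[OF _ S] by simp
    ultimately have wt: "weight \<nu> - weight (?i S) = k - card S" by linarith
    have "minor k f (?i S) = det (mat k k (\<lambda>(j, r). h r (?y S j)))"
      unfolding minor_def
      by (intro arg_cong[of _ _ det] eq_matI) (auto simp: eq[symmetric] h_def)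
    then show "w ^ (weight \<nu> - weight (?i S)) * minor k f (?i S)
        = w ^ (k - card S) * det (mat k k (\<lambda>(j, r). h r (?y S j)))"
      by (simp only: wt)
  next
    fix \<kappa> assume "\<kappa> \<in> ?U"
    then have i: "\<kappa> \<prec> \<nu>" by simp
    note \<kappa> = U[OF i]
    have eq: "?y (?j \<kappa>) j = Suc (position k \<kappa> j)" if "j < k" for j
    proof -
      have "position k \<kappa> j = ?x j \<or> Suc (position k \<kappa> j) = ?x j"
        using i that unfolding interlaces_position[OF \<kappa> \<nu>] by (metis le_SucE le_antisym)
      then show ?thesis using that by auto
    qed
    have s: "strict_mono_on {..<k} (?y (?j \<kappa>))"
      using position_strict_mono[OF \<kappa>] eq by (simp add: strict_mono_on_def)
    have "?y (?j \<kappa>) j \<noteq> 0" if "j < k" for j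
      unfolding eq[OF that] by simp
    with s show "?j \<kappa> \<in> ?P" by (intro CollectI conjI allI impI) auto
    have s': "strict_mono_on {..<k} (\<lambda>j. ?y (?j \<kappa>) j - 1)"
      using position_strict_mono[OF \<kappa>] eq by (simp add: strict_mono_on_def)
    show "?i (?j \<kappa>) = \<kappa>"
      by (rule position_inject[OF of_positions(1)[OF s'] \<kappa>]) (simp only: of_positions(2)[OF s'] eq diff_Suc_1)
  qed
  finally show ?thesis .
qed

text \<open>
  Two steps of a Dyck path seen from its even heights \<open>2 * x\<close>; the up steps from odd heights carry
  the weight \<open>w\<close>.
\<close>

definition hop :: "'a::comm_ring_1 \<Rightarrow> (nat \<Rightarrow> 'a) \<Rightarrow> nat \<Rightarrow> 'a" where
  "hop w f x = (f x + f (Suc x)) + (if x = 0 then 0 else w * (f (x - 1) + f (Suc (x - 1))))"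

definition unit_at :: "nat \<Rightarrow> nat \<Rightarrow> 'a::comm_ring_1" where
  "unit_at r x = of_bool (x = r)"

lemma minor_hop:
  assumes \<nu>: "\<nu> \<in> bounded_partitions k"
  shows "minor k (\<lambda>r. hop w (f r)) \<nu>
    = (\<Sum>\<kappa> | \<kappa> \<prec> \<nu>. w ^ (weight \<nu> - weight \<kappa>)
        * (\<Sum>\<mu> | \<mu> \<in> bounded_partitions k \<and> \<kappa> \<prec> \<mu>. minor k f \<mu>))"
proof -
  have "\<kappa> \<in> bounded_partitions k" if "\<kappa> \<prec> \<nu>" for \<kappa>
    using \<nu> by (auto elim!: bounded_partitionsE intro: parts_bounded interlaces_parts[OF that])
  then show ?thesis
    unfolding hop_def using minor_remove_strip[OF \<nu>, of "\<lambda>r x. f r x + f r (Suc x)" w]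
    by (simp add: minor_add_strip)
qed

lemma hop_support:
  "(hop w ^^ i) (unit_at r) x = 0" if "x > r + i" for w :: "'a::comm_ring_1"
  using that by (induction i arbitrary: x) (auto simp: unit_at_def hop_def)

lemma minor_zero_unless_short:
  assumes \<mu>: "\<mu> \<in> bounded_partitions k" "\<mu> \<notin> parts k i"
  shows "minor k (\<lambda>r. (hop w ^^ i) (unit_at r)) \<mu> = 0"
proof -
  obtain j where "j \<ge> i" "\<mu> j \<noteq> 0" using \<mu> by (auto simp: parts_def bounded_partitions_def)
  then have "0 < \<mu> i" using \<mu> antimonoD[of \<mu> i j] by (auto simp: bounded_partitions_def)
  then have c: "i < columns \<mu> 0" using less_columns_iff[OF \<mu>(1)] by simp
  have "\<mu> i \<le> k" using \<mu>(1) antimonoD[of \<mu> 0 i] by (auto simp: bounded_partitions_def)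
  then have k: "0 < k" using \<open>0 < \<mu> i\<close> by simp
  show ?thesis
    unfolding minor_def
    by (rule det_zero_row[of _ k "k - 1"]) (use k c in \<open>auto simp: position_def intro!: hop_support\<close>)
qed

fun chain_sum :: "'a::comm_ring_1 \<Rightarrow> nat \<Rightarrow> nat \<Rightarrow> (nat \<Rightarrow> nat) \<Rightarrow> 'a" where
  "chain_sum w k 0 \<nu> = of_bool (\<nu> = (\<lambda>_. 0))"
| "chain_sum w k (Suc i) \<nu> = (\<Sum>\<mu>\<in>parts k i. chain_sum w k i \<mu> * transfer_weight w \<mu> \<nu>)"

text \<open>
  The Lindstroem-Gessel-Viennot lemma for the paths at hand: both sides satisfy the recursion of
  \<open>minor_hop\<close>. At time \<open>0\<close> the paths occupy the lowest \<open>k\<close> heights, which is the empty partition.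
  The recursion for \<open>minor\<close> sums over all partitions, but those with more than \<open>i\<close> parts do not
  contribute since a path cannot rise by more than \<open>i\<close> in \<open>i\<close> hops.
\<close>

lemma chain_sum_minor:
  fixes w :: "'a::comm_ring_1"
  assumes "\<nu> \<in> bounded_partitions k"
  shows "chain_sum w k i \<nu> = minor k (\<lambda>r. (hop w ^^ i) (unit_at r)) \<nu>"
  using assms
proof (induction i arbitrary: \<nu>)
  case 0
  show ?case
  proof (cases "\<nu> = (\<lambda>_. 0)")
    case True
    have "mat k k (\<lambda>(j, r). unit_at r j) = (1\<^sub>m k :: 'a mat)"
      by (rule eq_matI) (auto simp: unit_at_def)
    then show ?thesis using True by (simp add: minor_def position_zero)
  next
    case False
    then have "\<nu> \<notin> parts k 0" by (auto simp: parts_def)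
    then show ?thesis using minor_zero_unless_short[OF 0, of 0 w] False by simp
  qed
next
  case (Suc i)
  let ?m = "minor k (\<lambda>r. (hop w ^^ i) (unit_at r))"
  obtain N where N: "\<nu> \<in> parts k N" using Suc.prems by (rule bounded_partitionsE)
  have fin: "finite {\<kappa>. \<kappa> \<prec> \<nu>}"
    by (rule finite_subset[of _ "parts k N"]) (use interlaces_parts[OF _ N] in auto)
  have fin2: "finite {\<mu>. \<mu> \<in> bounded_partitions k \<and> \<kappa> \<prec> \<mu>}" if "\<kappa> \<prec> \<nu>" for \<kappa>
  proof (rule finite_subset)
    have "\<kappa> j = 0" if "j \<ge> N" for j using interlaces_parts[OF \<open>\<kappa> \<prec> \<nu>\<close> N] that by (simp add: parts_def)
    then have "\<mu> j = 0" if "\<kappa> \<prec> \<mu>" "j \<ge> Suc N" for \<mu> j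
      using that unfolding interlaces_def by (metis Suc_le_D Suc_le_mono le_zero_eq)
    then show "{\<mu>. \<mu> \<in> bounded_partitions k \<and> \<kappa> \<prec> \<mu>} \<subseteq> parts k (Suc N)"
      by (auto simp: bounded_partitions_def parts_def)
  qed simp
  have "chain_sum w k (Suc i) \<nu> = (\<Sum>\<mu>\<in>parts k i. ?m \<mu> * transfer_weight w \<mu> \<nu>)"
    using Suc.IH by (simp add: parts_bounded)
  also have "\<dots> = (\<Sum>\<mu>\<in>parts k i. \<Sum>\<kappa> | \<kappa> \<in> {\<kappa>. \<kappa> \<prec> \<nu>} \<and> \<kappa> \<prec> \<mu>. w ^ (weight \<nu> - weight \<kappa>) * ?m \<mu>)"
    by (simp add: transfer_weight_def sum_distrib_left mult.commute conj_commute)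
  also have "\<dots> = (\<Sum>\<kappa>\<in>{\<kappa>. \<kappa> \<prec> \<nu>}. \<Sum>\<mu> | \<mu> \<in> parts k i \<and> \<kappa> \<prec> \<mu>. w ^ (weight \<nu> - weight \<kappa>) * ?m \<mu>)"
    by (rule sum.swap_restrict) (use fin in auto)
  also have "\<dots> = (\<Sum>\<kappa>\<in>{\<kappa>. \<kappa> \<prec> \<nu>}. w ^ (weight \<nu> - weight \<kappa>)
        * (\<Sum>\<mu> | \<mu> \<in> bounded_partitions k \<and> \<kappa> \<prec> \<mu>. ?m \<mu>))"
  proof (rule sum.cong[OF refl])
    fix \<kappa> assume "\<kappa> \<in> {\<kappa>. \<kappa> \<prec> \<nu>}"
    then have "(\<Sum>\<mu> | \<mu> \<in> bounded_partitions k \<and> \<kappa> \<prec> \<mu>. ?m \<mu>) = (\<Sum>\<mu> | \<mu> \<in> parts k i \<and> \<kappa> \<prec> \<mu>. ?m \<mu>)"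
      using fin2[of \<kappa>] minor_zero_unless_short[of _ k i w]
      by (intro sum.mono_neutral_right) (auto intro: parts_bounded)
    then show "(\<Sum>\<mu> | \<mu> \<in> parts k i \<and> \<kappa> \<prec> \<mu>. w ^ (weight \<nu> - weight \<kappa>) * ?m \<mu>)
        = w ^ (weight \<nu> - weight \<kappa>) * (\<Sum>\<mu> | \<mu> \<in> bounded_partitions k \<and> \<kappa> \<prec> \<mu>. ?m \<mu>)"
      by (simp add: sum_distrib_left)
  qed
  also have "\<dots> = minor k (\<lambda>r. (hop w ^^ Suc i) (unit_at r)) \<nu>"
    using minor_hop[OF Suc.prems, of w "\<lambda>r. (hop w ^^ i) (unit_at r)"] by simp
  finally show ?case .
qed

lemma families_chain_sum:
  fixes w :: "'a::comm_ring_1"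
  assumes "n \<ge> 1"
  shows "(\<Sum>L\<in>families k n. \<Prod>i<n. transfer_weight w (L i) ((L(n := \<nu>)) (Suc i))) = chain_sum w k n \<nu>"
  using assms
proof (induction n arbitrary: \<nu> rule: dec_induct)
  case base
  have "families k 1 = {\<lambda>i j. 0}" by (auto simp: families_def)
  moreover have "parts k 0 = {\<lambda>_. 0}" by (auto simp: parts_def antimono_def)
  ultimately show ?case by simp
next
  case (step n)
  have "(\<Sum>L\<in>families k (Suc n). \<Prod>i<Suc n. transfer_weight w (L i) ((L(Suc n := \<nu>)) (Suc i)))
      = (\<Sum>(M, \<mu>)\<in>families k n \<times> parts k n.
          (\<Prod>i<n. transfer_weight w (M i) ((M(n := \<mu>)) (Suc i))) * transfer_weight w \<mu> \<nu>)"
  proof (rule sum.reindex_bij_witness[of _ "\<lambda>(M, \<mu>). M(n := \<mu>)" "\<lambda>L. (L(n := (\<lambda>_. 0)), L n)"])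
    fix L assume L: "L \<in> families k (Suc n)"
    show "(case (L(n := (\<lambda>_. 0)), L n) of (M, \<mu>) \<Rightarrow> M(n := \<mu>)) = L" by simp
    show "(L(n := (\<lambda>_. 0)), L n) \<in> families k n \<times> parts k n"
      using L step.hyps by (auto simp: families_def)
    show "(case (L(n := (\<lambda>_. 0)), L n) of (M, \<mu>) \<Rightarrow>
          (\<Prod>i<n. transfer_weight w (M i) ((M(n := \<mu>)) (Suc i))) * transfer_weight w \<mu> \<nu>)
        = (\<Prod>i<Suc n. transfer_weight w (L i) ((L(Suc n := \<nu>)) (Suc i)))"
      unfolding prod.case prod.lessThan_Suc
      by (intro arg_cong2[of _ _ _ _ "(*)"] prod.cong refl) auto
  next
    fix x assume "x \<in> families k n \<times> parts k n"
    then obtain M \<mu> where x: "x = (M, \<mu>)" "M \<in> families k n" "\<mu> \<in> parts k n" by auto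
    then have "M n = (\<lambda>_. 0)" by (auto simp: families_def)
    then show "((case x of (M, \<mu>) \<Rightarrow> M(n := \<mu>))(n := (\<lambda>_. 0)), (case x of (M, \<mu>) \<Rightarrow> M(n := \<mu>)) n) = x"
      using x by auto
    show "(case x of (M, \<mu>) \<Rightarrow> M(n := \<mu>)) \<in> families k (Suc n)"
      using x step.hyps by (auto simp: families_def)
  qed
  also have "\<dots> = (\<Sum>\<mu>\<in>parts k n. chain_sum w k n \<mu> * transfer_weight w \<mu> \<nu>)"
    by (subst sum.cartesian_product[symmetric], subst sum.swap)
      (simp add: sum_distrib_right[symmetric] step.IH del: fun_upd_apply)
  finally show ?case by simp
qed

lemma displacements_determinant:
  fixes w :: "'a::comm_ring_1"
  assumes "n \<ge> 1"
  shows "(\<Sum>m\<in>displacements n k. w ^ excess n m)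
    = det (mat k k (\<lambda>(j, r). (hop w ^^ n) (unit_at r) j))"
proof -
  have "(\<Sum>m\<in>displacements n k. w ^ excess n m)
      = (\<Sum>L\<in>families k n. \<Prod>i<n. transfer_weight w (L i) (L (Suc i)))"
    using displacements_families[OF assms, where F = "\<lambda>_. 1"] by simp
  also have "\<dots> = (\<Sum>L\<in>families k n. \<Prod>i<n. transfer_weight w (L i) ((L(n := (\<lambda>_. 0))) (Suc i)))"
  proof (rule sum.cong[OF refl])
    fix L assume "L \<in> families k n"
    then have "L(n := (\<lambda>_. 0)) = L" by (auto simp: families_def)
    then show "(\<Prod>i<n. transfer_weight w (L i) (L (Suc i))) = (\<Prod>i<n. transfer_weight w (L i) ((L(n := (\<lambda>_. 0))) (Suc i)))"
      by simp
  qed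
  also have "\<dots> = det (mat k k (\<lambda>(j, r). (hop w ^^ n) (unit_at r) j))"
    unfolding families_chain_sum[OF assms] chain_sum_minor[OF zero_bounded] minor_def position_zero ..
  finally show ?thesis .
qed

section \<open>Motzkin and Schroeder paths\<close>

text \<open>
  Weighted Motzkin paths of length \<open>n\<close>, by first return to the ground: \<open>a\<close> is the weight of a
  horizontal step and \<open>b\<close> that of a pair of matching up and down steps.
\<close>

fun motzkin :: "'a::comm_ring_1 \<Rightarrow> 'a \<Rightarrow> nat \<Rightarrow> 'a" where
  "motzkin a b 0 = 1"
| "motzkin a b (Suc n) = a * motzkin a b n
    + b * (\<Sum>i<n. motzkin a b i * motzkin a b (n - 1 - i))"

lemma motzkin_scale: "motzkin (c * a) (c ^ 2 * b) n = c ^ n * motzkin a b n"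
proof (induction n rule: less_induct)
  case (less n)
  show ?case
  proof (cases n)
    case (Suc n)
    have "motzkin (c * a) (c ^ 2 * b) i * motzkin (c * a) (c ^ 2 * b) (n - 1 - i)
        = c ^ (n - 1) * (motzkin a b i * motzkin a b (n - 1 - i))" if "i < n" for i
    proof -
      have "c ^ (n - 1) = c ^ i * c ^ (n - 1 - i)" using that by (simp add: power_add[symmetric])
      then show ?thesis using less Suc that by (simp add: mult_ac)
    qed
    then have sums: "(\<Sum>i<n. motzkin (c * a) (c ^ 2 * b) i * motzkin (c * a) (c ^ 2 * b) (n - 1 - i))
        = c ^ (n - 1) * (\<Sum>i<n. motzkin a b i * motzkin a b (n - 1 - i))"
      by (simp add: sum_distrib_left)
    have IH: "motzkin (c * a) (c ^ 2 * b) n = c ^ n * motzkin a b n" using less Suc by simp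
    show ?thesis
    proof (cases "n = 0")
      case False
      let ?s = "\<Sum>i<n. motzkin a b i * motzkin a b (n - 1 - i)"
      have "c ^ Suc n = c ^ 2 * c ^ (n - 1)"
        using False by (cases n) (simp_all add: power2_eq_square mult_ac)
      moreover have "motzkin (c * a) (c ^ 2 * b) (Suc n)
          = c * a * (c ^ n * motzkin a b n) + c ^ 2 * b * (c ^ (n - 1) * ?s)"
        by (simp only: motzkin.simps IH sums)
      moreover have "c ^ Suc n * motzkin a b (Suc n)
          = c ^ Suc n * (a * motzkin a b n) + c ^ Suc n * (b * ?s)"
        by (simp add: distrib_left)
      moreover have "c ^ Suc n * (a * motzkin a b n) = c * a * (c ^ n * motzkin a b n)"
        by (simp add: mult_ac)
      ultimately show ?thesis using Suc by (simp add: mult_ac)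
    qed (simp add: Suc)
  qed simp
qed

definition motzkin_fps :: "'a::comm_ring_1 \<Rightarrow> 'a \<Rightarrow> 'a fps" where
  "motzkin_fps a b = Abs_fps (motzkin a b)"

lemma motzkin_fps_equation:
  "motzkin_fps a b = 1 + fps_const a * fps_X * motzkin_fps a b
    + fps_const b * fps_X\<^sup>2 * motzkin_fps a b * motzkin_fps a b" (is "?M = ?R")
proof (rule fps_ext)
  fix n
  have R: "?R = 1 + fps_const a * (fps_X * ?M) + fps_const b * (fps_X * (fps_X * (?M * ?M)))"
    by (simp add: power2_eq_square mult_ac)
  show "fps_nth ?M n = fps_nth ?R n"
  proof (cases n)
    case 0
    then show ?thesis unfolding R by (simp add: motzkin_fps_def)
  next
    case (Suc n)
    show ?thesis
    proof (cases n)
      case 0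
      then show ?thesis unfolding R Suc by (simp add: motzkin_fps_def)
    next
      case (Suc l)
      have "fps_nth (?M * ?M) l = (\<Sum>i<Suc l. motzkin a b i * motzkin a b (l - i))"
        by (simp add: fps_mult_nth motzkin_fps_def atLeast0AtMost lessThan_Suc_atMost)
      then show ?thesis unfolding R \<open>n = Suc l\<close> \<open>_ = Suc n\<close> by (simp add: motzkin_fps_def)
    qed
  qed
qed

text \<open>
  Generalises \<open>little_schroeder_paths\<close> to an arbitrary starting point, so that the first step can be
  split off.
\<close>

definition schroeder_walks :: "int \<Rightarrow> int \<Rightarrow> int \<Rightarrow> step list set" where
  "schroeder_walks x h m = {w. walk (x, h) w = (m, 0)
     \<and> (\<forall>t \<le> length w. 0 \<le> snd (walk (x, h) (take t w)))
     \<and> (\<forall>t < length w. w ! t = Horizontal \<longrightarrow> snd (walk (x, h) (take t w)) \<noteq> 0)}"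

lemma Nil_in_schroeder_walks: "[] \<in> schroeder_walks x h m \<longleftrightarrow> x = m \<and> h = 0"
  by (auto simp: schroeder_walks_def)

lemma Cons_in_schroeder_walks:
  "s # w \<in> schroeder_walks x h m \<longleftrightarrow> 0 \<le> h \<and> (s = Horizontal \<longrightarrow> h \<noteq> 0)
    \<and> w \<in> schroeder_walks (x + fst (step_vec s)) (h + snd (step_vec s)) m"
proof -
  have all_le: "(\<forall>t \<le> Suc n. P t) \<longleftrightarrow> P 0 \<and> (\<forall>t \<le> n. P (Suc t))" for P n
    by (metis Suc_le_mono not0_implies_Suc zero_le)
  have all_less: "(\<forall>t < Suc n. P t) \<longleftrightarrow> P 0 \<and> (\<forall>t < n. P (Suc t))" for P n
    by (rule All_less_Suc2)
  show ?thesis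
    unfolding schroeder_walks_def mem_Collect_eq length_Cons all_le all_less
    by (simp add: conj_ac)
qed

lemma schroeder_walks_below: "w \<in> schroeder_walks x h m \<Longrightarrow> 0 \<le> h"
  by (cases w) (auto simp: Nil_in_schroeder_walks Cons_in_schroeder_walks)

lemma schroeder_walks_beyond: "w \<in> schroeder_walks x h m \<Longrightarrow> x + h \<le> m"
proof (induction w arbitrary: x h)
  case (Cons s w)
  then show ?case by (cases s) (force simp: Cons_in_schroeder_walks)+
qed (simp add: Nil_in_schroeder_walks)

lemma schroeder_walks_steps:
  assumes "0 \<le> h"
  shows "schroeder_walks x h m = (if x = m \<and> h = 0 then {[]} else {})
    \<union> (#) Up ` schroeder_walks (x + 1) (h + 1) m
    \<union> (#) Down ` schroeder_walks (x + 1) (h - 1) m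
    \<union> (if h = 0 then {} else (#) Horizontal ` schroeder_walks (x + 2) h m)"
    (is "_ = ?R")
proof -
  have "w \<in> schroeder_walks x h m \<longleftrightarrow> w \<in> ?R" for w
  proof (cases w)
    case Nil
    then show ?thesis by (auto simp: Nil_in_schroeder_walks)
  next
    case (Cons s w')
    then show ?thesis using assms by (cases s) (auto simp: Cons_in_schroeder_walks)
  qed
  then show ?thesis by blast
qed

text \<open>
  In the classical decomposition, \<open>R\<close> counts Schroeder paths with horizontal steps allowed
  everywhere and \<open>S\<close> those with none on the axis. A path from height \<open>h\<close> is cut where it first
  reaches each lower height, which suggests \<open>S * R ^ h\<close>; the proof only checks that these coefficients
  obey the first-step recursion. The exponent \<open>n\<close> of the series is half the excess of the horizontal
  distance over \<open>h\<close>.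
\<close>

lemma card_schroeder_walks:
  fixes S R :: "int fps"
  assumes R: "R = 1 + fps_X * R + fps_X * R\<^sup>2" and S: "S = 1 + fps_X * R * S"
  shows "finite (schroeder_walks (m - int (h + 2 * n)) (int h) m)
    \<and> int (card (schroeder_walks (m - int (h + 2 * n)) (int h) m)) = fps_nth (S * R ^ h) n"
proof (induction "h + 2 * n" arbitrary: h n rule: less_induct)
  case less
  let ?W = "\<lambda>h n. schroeder_walks (m - int (h + 2 * n)) (int h) m"
  let ?x = "m - int (h + 2 * n)"
  have up: "n > 0 \<Longrightarrow> finite (?W (Suc h) (n - 1)) \<and> int (card (?W (Suc h) (n - 1))) = fps_nth (S * R ^ Suc h) (n - 1)"
    by (rule less) simp
  have up0: "n = 0 \<Longrightarrow> schroeder_walks (?x + 1) (int h + 1) m = {}"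
    using schroeder_walks_beyond[of _ "?x + 1" "int h + 1" m] by force
  have up1: "n > 0 \<Longrightarrow> schroeder_walks (?x + 1) (int h + 1) m = ?W (Suc h) (n - 1)"
    by (rule arg_cong3[of _ _ _ _ _ _ schroeder_walks]) auto
  have ups: "finite (schroeder_walks (?x + 1) (int h + 1) m)
      \<and> int (card (schroeder_walks (?x + 1) (int h + 1) m)) = fps_nth (fps_X * (S * R ^ Suc h)) n"
    using up up0 up1 by (cases "n = 0") simp_all
  show ?case
  proof (cases "h = 0")
    case True
    have dn: "schroeder_walks (?x + 1) (int h - 1) m = {}"
      using schroeder_walks_below True by force
    have eq: "?W h n = (if n = 0 then {[]} else {}) \<union> (#) Up ` schroeder_walks (?x + 1) (int h + 1) m"
      by (subst schroeder_walks_steps) (use True dn in auto)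
    have "card (?W h n) = of_bool (n = 0) + card (schroeder_walks (?x + 1) (int h + 1) m)"
      unfolding eq using ups by (subst card_Un_disjoint) (auto simp: card_image)
    moreover have "S * R ^ h = 1 + fps_X * (S * R ^ Suc h)"
      using True S by (simp add: mult_ac)
    from arg_cong[OF this, of "\<lambda>f. fps_nth f n"] have "fps_nth (S * R ^ h) n = of_bool (n = 0) + fps_nth (fps_X * (S * R ^ Suc h)) n"
      by (simp only: fps_add_nth fps_one_nth of_bool_def)
    ultimately show ?thesis using ups eq by simp
  next
    case False
    then obtain g where h: "h = Suc g" by (cases h) auto
    have down: "finite (?W g n) \<and> int (card (?W g n)) = fps_nth (S * R ^ g) n"
      by (rule less) (simp add: h)
    have dn: "schroeder_walks (?x + 1) (int h - 1) m = ?W g n"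
      by (rule arg_cong3[of _ _ _ _ _ _ schroeder_walks]) (auto simp: h)
    have hor: "n > 0 \<Longrightarrow> finite (?W h (n - 1)) \<and> int (card (?W h (n - 1))) = fps_nth (S * R ^ h) (n - 1)"
      by (rule less) simp
    have hor0: "n = 0 \<Longrightarrow> schroeder_walks (?x + 2) (int h) m = {}"
      using schroeder_walks_beyond[of _ "?x + 2" "int h" m] by force
    have hor1: "n > 0 \<Longrightarrow> schroeder_walks (?x + 2) (int h) m = ?W h (n - 1)"
      by (rule arg_cong3[of _ _ _ _ _ _ schroeder_walks]) auto
    have hors: "finite (schroeder_walks (?x + 2) (int h) m)
        \<and> int (card (schroeder_walks (?x + 2) (int h) m)) = fps_nth (fps_X * (S * R ^ h)) n"
      using hor hor0 hor1 by (cases "n = 0") simp_all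
    have eq: "?W h n = (#) Up ` schroeder_walks (?x + 1) (int h + 1) m
        \<union> ((#) Down ` ?W g n \<union> (#) Horizontal ` schroeder_walks (?x + 2) (int h) m)"
      by (subst schroeder_walks_steps) (use False dn in auto)
    have "card (?W h n) = card (schroeder_walks (?x + 1) (int h + 1) m)
        + (card (?W g n) + card (schroeder_walks (?x + 2) (int h) m))"
      unfolding eq using ups down hors
      by (subst card_Un_disjoint, auto simp: card_image)+
    moreover have split: "S * R ^ h = fps_X * (S * R ^ Suc h) + (S * R ^ g + fps_X * (S * R ^ h))"
    proof -
      have "S * R ^ h = S * R ^ g * (1 + fps_X * R + fps_X * R\<^sup>2)"
        using R[symmetric] by (simp add: h mult_ac)
      then show ?thesis by (simp add: h algebra_simps power2_eq_square)
    qed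
    from arg_cong[OF split, of "\<lambda>f. fps_nth f n"]
    have "fps_nth (S * R ^ h) n = fps_nth (fps_X * (S * R ^ Suc h)) n + (fps_nth (S * R ^ g) n + fps_nth (fps_X * (S * R ^ h)) n)"
      by (simp only: fps_add_nth)
    ultimately show ?thesis using ups down hors eq by simp
  qed
qed

text \<open>
  The equations for \<open>R\<close> and \<open>S\<close> are solved by \<open>1 + 2 * X * M\<close> and \<open>1 + X * M\<close>, where \<open>M\<close> is the series of
  Motzkin paths with weights \<open>3\<close> and \<open>2\<close>.
\<close>

lemma little_schroeder_motzkin: "int (little_schroeder (Suc n)) = motzkin 3 2 n"
proof -
  define M :: "int fps" where "M = motzkin_fps 3 2"
  define R where "R = 1 + 2 * fps_X * M"
  define S where "S = 1 + fps_X * M"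
  have M: "M = 1 + 3 * fps_X * M + 2 * fps_X\<^sup>2 * M * M"
    using motzkin_fps_equation[of "3::int" 2] by (simp add: M_def fps_numeral_fps_const)
  have R: "R = 1 + fps_X * R + fps_X * R\<^sup>2"
  proof -
    have "fps_X * R + fps_X * R\<^sup>2 = 2 * fps_X * (1 + 3 * fps_X * M + 2 * fps_X\<^sup>2 * M * M)"
      by (simp add: R_def algebra_simps power2_eq_square)
    then show ?thesis unfolding M[symmetric] by (simp add: R_def)
  qed
  have S: "S = 1 + fps_X * R * S"
  proof -
    have "fps_X * R * S = fps_X * (1 + 3 * fps_X * M + 2 * fps_X\<^sup>2 * M * M)"
      by (simp add: R_def S_def algebra_simps power2_eq_square)
    then show ?thesis unfolding M[symmetric] by (simp add: S_def)
  qed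
  have "little_schroeder_paths (Suc n) = schroeder_walks (- int (Suc n)) 0 (int (Suc n))"
    by (simp add: little_schroeder_paths_def schroeder_walks_def)
  moreover have "int (Suc n) - int (0 + 2 * Suc n) = - int (Suc n)" by simp
  ultimately have "int (little_schroeder (Suc n)) = fps_nth (S * R ^ 0) (Suc n)"
    using card_schroeder_walks[OF R S, of "int (Suc n)" 0 "Suc n"]
    by (simp add: little_schroeder_def)
  then show ?thesis by (simp add: S_def M_def motzkin_fps_def)
qed

section \<open>The Hankel determinant of moments\<close>

text \<open>
  Unfolds only the outermost application of \<open>hop\<close>; rewriting with \<open>hop_def\<close> would also unfold the
  operator inside the iteration.
\<close>

lemma hop_Suc:
  "(hop w ^^ Suc i) f y = ((hop w ^^ i) f y + (hop w ^^ i) f (Suc y))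
    + (if y = 0 then 0 else w * ((hop w ^^ i) f (y - 1) + (hop w ^^ i) f (Suc (y - 1))))"
  unfolding funpow.simps comp_apply by (rule hop_def)

lemma hop_expand:
  fixes w :: "'a::comm_ring_1"
  assumes "y + i < K"
  shows "(hop w ^^ i) f y = (\<Sum>x<K. (hop w ^^ i) (unit_at x) y * f x)"
  using assms
proof (induction i arbitrary: y)
  case 0
  have "(\<Sum>x<K. unit_at x y * f x) = (\<Sum>x<K. if x = y then f x else 0)"
    by (rule sum.cong) (auto simp: unit_at_def)
  then show ?case using 0 by simp
next
  case (Suc i)
  have IH: "(hop w ^^ i) f z = (\<Sum>x<K. (hop w ^^ i) (unit_at x) z * f x)" if "z \<le> Suc y" for z
    using Suc that by simp
  show ?case
    unfolding hop_Suc
    by (simp add: IH sum.distrib sum_distrib_left distrib_left distrib_right mult.assoc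
        del: funpow.simps)
qed

lemma hop_lower_support:
  fixes w :: "'a::comm_ring_1"
  shows "y + i < x \<Longrightarrow> (hop w ^^ i) (unit_at x) y = 0"
proof (induction i arbitrary: y)
  case (Suc i)
  then show ?case unfolding hop_Suc by simp
qed (simp add: unit_at_def)

lemma hop_descend:
  fixes w :: "'a::comm_ring_1"
  shows "(hop w ^^ i) (unit_at (y + i)) y = 1"
proof (induction i arbitrary: y)
  case (Suc i)
  have "(hop w ^^ i) (unit_at (y + Suc i)) (Suc y) = 1" using Suc[of "Suc y"] by simp
  then show ?case unfolding hop_Suc by (simp add: hop_lower_support)
qed (simp add: unit_at_def)

lemma hop_ascend:
  fixes w :: "'a::comm_ring_1"
  shows "(hop w ^^ i) (unit_at 0) i = w ^ i"
proof (induction i)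
  case (Suc i)
  then show ?case unfolding hop_Suc by (simp add: hop_support)
qed (simp add: unit_at_def)

text \<open>
  Away from the ground \<open>hop\<close> has constant weights \<open>1\<close>, \<open>1 + w\<close> and \<open>w\<close>. So the series for height \<open>x\<close>
  decreases geometrically in \<open>x\<close>, with ratio \<open>w * X * M\<close>; at the ground the horizontal weight is \<open>1\<close>
  instead, which yields the factor \<open>1 + X * M\<close>.
\<close>

lemma hop_generating_function:
  fixes w :: "'a::comm_ring_1"
  defines "M \<equiv> motzkin_fps (1 + w) w"
  shows "(hop w ^^ m) (unit_at 0) x
    = fps_nth ((1 + fps_X * M) * (fps_const w * fps_X * M) ^ x) m"
proof -
  define V where "V = 1 + fps_X * M"
  define P where "P = fps_const w * fps_X * M"
  have M: "M = 1 + fps_const (1 + w) * fps_X * M + fps_const w * fps_X\<^sup>2 * M * M"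
    unfolding M_def by (rule motzkin_fps_equation)
  have c: "fps_const (1 + w) = 1 + fps_const w" by (metis fps_const_1_eq_1 fps_const_add)
  have base: "V = 1 + fps_X * (V + V * P)"
  proof -
    have "V + V * P = 1 + fps_const (1 + w) * fps_X * M + fps_const w * fps_X\<^sup>2 * M * M"
      by (simp add: V_def P_def c algebra_simps power2_eq_square)
    then show ?thesis unfolding M[symmetric] by (simp add: V_def)
  qed
  have P: "P = fps_X * (P + P * P + fps_const w * (1 + P))"
  proof -
    have "P + P * P + fps_const w * (1 + P)
        = fps_const w * (1 + fps_const (1 + w) * fps_X * M + fps_const w * fps_X\<^sup>2 * M * M)"
      by (simp add: P_def c algebra_simps power2_eq_square)
    then show ?thesis unfolding M[symmetric] by (simp add: P_def mult_ac)
  qed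
  have step: "V * P ^ Suc y = fps_X * (V * P ^ Suc y + V * P ^ Suc (Suc y)
      + fps_const w * (V * P ^ y + V * P ^ Suc y))" for y
  proof -
    have "V * P ^ Suc y = V * P ^ y * (fps_X * (P + P * P + fps_const w * (1 + P)))"
      using P by (simp add: mult_ac)
    then show ?thesis by (simp add: algebra_simps)
  qed
  have "(hop w ^^ m) (unit_at 0) x = fps_nth (V * P ^ x) m"
  proof (induction m arbitrary: x)
    case 0
    show ?case by (cases x) (simp_all add: unit_at_def V_def P_def mult.assoc)
  next
    case (Suc m)
    show ?case
    proof (cases x)
      case 0
      have "fps_nth (V * P ^ 0) (Suc m) = fps_nth (1 + fps_X * (V * P ^ 0 + V * P ^ 1)) (Suc m)"
        using base by simp
      then show ?thesis unfolding 0 hop_Suc Suc by (simp del: power_Suc)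
    next
      case (Suc y)
      have "fps_nth (V * P ^ Suc y) (Suc m) = fps_nth (V * P ^ Suc y + V * P ^ Suc (Suc y)
          + fps_const w * (V * P ^ y + V * P ^ Suc y)) m"
        by (subst step) simp
      then show ?thesis unfolding Suc hop_Suc Suc.IH by (simp del: power_Suc)
    qed
  qed
  then show ?thesis by (simp add: V_def P_def)
qed

lemma of_int_motzkin: "of_int (motzkin a b n) = motzkin (of_int a) (of_int b) n"
proof (induction n rule: less_induct)
  case (less n)
  show ?case by (cases n) (simp_all add: less)
qed

text \<open>
  For \<open>w = 1/2\<close> the Motzkin weights are \<open>3/2\<close> and \<open>1/2\<close>, which is \<open>3\<close> and \<open>2\<close> after scaling each unit of
  length by \<open>1/2\<close>.
\<close>

lemma scaled_schroeder_moment: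
  assumes "m \<ge> 1"
  shows "rat_of_nat (scaled_schroeder m) = 2 * 4 ^ m * (hop (1 / 2) ^^ m) (unit_at 0) 0"
proof -
  obtain n where m: "m = Suc n" using assms by (cases m) auto
  have "(hop (1 / 2) ^^ m) (unit_at 0) 0 = motzkin (3 / 2) (1 / 2 :: rat) n"
    unfolding hop_generating_function m by (simp add: motzkin_fps_def)
  also have "\<dots> = motzkin (1 / 2 * 3) ((1 / 2) ^ 2 * 2) n" by (simp add: power2_eq_square)
  also have "\<dots> = (1 / 2) ^ n * motzkin 3 2 n" by (rule motzkin_scale)
  also have "motzkin 3 2 n = rat_of_int (motzkin 3 2 n)" by (simp add: of_int_motzkin)
  also have "\<dots> = rat_of_nat (little_schroeder m)"
    using little_schroeder_motzkin[of n] m by (metis of_int_of_nat_eq)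
  finally have eq: "(hop (1 / 2) ^^ m) (unit_at 0) 0 = (1 / 2) ^ n * rat_of_nat (little_schroeder m)" .
  have "(4 :: rat) ^ n = 2 ^ n * 2 ^ n" by (simp add: power_mult_distrib[symmetric])
  then show ?thesis
    unfolding eq by (simp add: scaled_schroeder_def m power_one_over)
qed

text \<open>
  A path of \<open>n + i + j\<close> hops from \<open>0\<close> to \<open>0\<close> is cut after the first \<open>j\<close> and before the last \<open>i\<close> hops. The
  outer pieces form triangular matrices, because \<open>i\<close> hops cannot connect height \<open>0\<close> with a height
  above \<open>i\<close>; their diagonals are the weights of the straight ascents and descents. The powers of
  \<open>q\<close> are spread over the two triangular factors.
\<close>

lemma hankel_determinant:
  fixes w q :: "'a::comm_ring_1"
  shows "det (mat k k (\<lambda>(i, j). q ^ (n + i + j) * (hop w ^^ (n + i + j)) (unit_at 0) 0))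
    = (\<Prod>i<k. q ^ (n + 2 * i) * w ^ i) * det (mat k k (\<lambda>(j, r). (hop w ^^ n) (unit_at r) j))"
proof -
  define A where "A = mat k k (\<lambda>(j, r). (hop w ^^ n) (unit_at r) j)"
  define L where "L = mat k k (\<lambda>(i, x). q ^ (n + i) * (hop w ^^ i) (unit_at x) 0)"
  define R where "R = mat k k (\<lambda>(r, j). q ^ j * (hop w ^^ j) (unit_at 0) r)"
  have carrier: "A \<in> carrier_mat k k" "L \<in> carrier_mat k k" "R \<in> carrier_mat k k"
    by (simp_all add: A_def L_def R_def)
  have "mat k k (\<lambda>(i, j). q ^ (n + i + j) * (hop w ^^ (n + i + j)) (unit_at 0) 0) = L * (A * R)"
    (is "?H = _")
  proof (rule eq_matI)
    fix i j assume "i < dim_row (L * (A * R))" "j < dim_col (L * (A * R))"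
    then have ij: "i < k" "j < k" by (simp_all add: L_def R_def)
    define F where "F = (hop w ^^ j) (unit_at 0)"
    have F0: "F x = 0" if "x > j" for x unfolding F_def by (rule hop_support) (use that in simp)
    have mid: "(hop w ^^ n) F x = (\<Sum>r<k. (hop w ^^ n) (unit_at r) x * F r)" for x
    proof -
      have "(hop w ^^ n) F x = (\<Sum>r<max k (Suc (x + n)). (hop w ^^ n) (unit_at r) x * F r)"
        by (rule hop_expand) simp
      also have "\<dots> = (\<Sum>r<k. (hop w ^^ n) (unit_at r) x * F r)"
        by (rule sum.mono_neutral_right) (use F0 ij in auto)
      finally show ?thesis .
    qed
    have "n + i + j = i + (n + j)" by simp
    then have "(hop w ^^ (n + i + j)) (unit_at 0) 0 = (hop w ^^ i) ((hop w ^^ n) F) 0"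
      by (simp only: F_def funpow_add comp_apply)
    also have "\<dots> = (\<Sum>x<k. (hop w ^^ i) (unit_at x) 0 * (hop w ^^ n) F x)"
      by (rule hop_expand) (use ij in simp)
    also have "\<dots> = (\<Sum>x<k. (hop w ^^ i) (unit_at x) 0 * (\<Sum>r<k. (hop w ^^ n) (unit_at r) x * F r))"
      by (simp only: mid)
    finally have main: "(hop w ^^ (n + i + j)) (unit_at 0) 0
        = (\<Sum>x<k. (hop w ^^ i) (unit_at x) 0 * (\<Sum>r<k. (hop w ^^ n) (unit_at r) x * F r))" .
    have "(L * (A * R)) $$ (i, j) = (\<Sum>x<k. q ^ (n + i) * (hop w ^^ i) (unit_at x) 0
        * (\<Sum>r<k. (hop w ^^ n) (unit_at r) x * (q ^ j * F r)))"
      using ij by (simp add: L_def A_def R_def F_def scalar_prod_def atLeast0LessThan)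
    also have "\<dots> = q ^ (n + i + j) * (\<Sum>x<k. (hop w ^^ i) (unit_at x) 0
        * (\<Sum>r<k. (hop w ^^ n) (unit_at r) x * F r))"
      by (simp add: sum_distrib_left power_add mult_ac)
    finally show "?H $$ (i, j) = (L * (A * R)) $$ (i, j)"
      using ij main by simp
  qed (simp_all add: L_def R_def)
  moreover have "det L = (\<Prod>i<k. q ^ (n + i))"
  proof -
    have "det L = prod_list (diag_mat L)"
      by (rule det_lower_triangular[OF _ carrier(2)]) (simp add: L_def hop_lower_support)
    then show ?thesis
      using hop_descend[of _ w 0]
      by (simp add: prod_list_diag_prod L_def atLeast0LessThan cong: prod.cong_simp)
  qed
  moreover have "det R = (\<Prod>j<k. q ^ j * w ^ j)"
  proof -
    have "det R = prod_list (diag_mat R)"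
      by (rule det_upper_triangular[OF _ carrier(3)]) (auto simp: R_def hop_support)
    then show ?thesis
      by (simp add: prod_list_diag_prod R_def hop_ascend atLeast0LessThan cong: prod.cong_simp)
  qed
  moreover have "(\<Prod>i<k. q ^ (n + i)) * (\<Prod>j<k. q ^ j * w ^ j) = (\<Prod>i<k. q ^ (n + 2 * i) * w ^ i)"
    unfolding prod.distrib[symmetric]
  proof (rule prod.cong[OF refl])
    fix i
    have "q ^ (n + 2 * i) = q ^ (n + i) * q ^ i"
      by (simp add: power_add[symmetric] mult_2 add.assoc)
    then show "q ^ (n + i) * (q ^ i * w ^ i) = q ^ (n + 2 * i) * w ^ i"
      by (simp only: mult.assoc)
  qed
  ultimately show ?thesis
    using carrier by (simp add: det_mult[of _ k] A_def[symmetric] mult_ac)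
qed

text \<open>
  For \<open>w = 1/2\<close> and \<open>q = 4\<close>, the power \<open>2 ^ (1 + 2 * n + 3 * i)\<close> is twice the factor \<open>q ^ (n + 2 * i) * w ^ i\<close>
  of \<open>hankel_determinant\<close>, and \<open>k choose 2\<close> is the exponent in front of the Schroeder determinant.
  So this splits the number of squares of the skew shape the way the final identity needs it.
\<close>

lemma card_skew_staircase:
  "card (triangle (n + 2 * k)) - card (triangle n) = (k choose 2) + (\<Sum>i<k. 1 + 2 * n + 3 * i)"
proof -
  have "card (triangle (n + 2 * k)) = card (triangle n) + (k choose 2) + (\<Sum>i<k. 1 + 2 * n + 3 * i)"
  proof (induction k)
    case (Suc k)
    have "card (triangle (Suc (Suc N))) = card (triangle N) + 2 * N + 1" for N
      using card_triangle[of N] card_triangle[of "Suc (Suc N)"] by (cases N) (auto simp: algebra_simps)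
    from this[of "n + 2 * k"]
    have "card (triangle (n + 2 * Suc k)) = card (triangle (n + 2 * k)) + 2 * (n + 2 * k) + 1"
      by simp
    moreover have "Suc k choose 2 = k + (k choose 2)"
      using binomial_Suc_Suc[of k 1] by (simp add: numeral_2_eq_2[symmetric])
    ultimately show ?case using Suc by simp
  qed simp
  then show ?thesis by simp
qed

theorem theorem1p1:
  fixes n k :: nat
  assumes "n \<ge> 1" and "k \<ge> 1"
  shows "int (num_pleasant (staircase (n + 2 * k)) (staircase n))
    = 2 ^ (k choose 2) * det (schroeder_matrix n k)"
proof -
  let ?A = "det (mat k k (\<lambda>(j, r). (hop (1 / 2) ^^ n) (unit_at r) j)) :: rat"
  have "map_mat rat_of_int (schroeder_matrix n k)
      = 2 \<cdot>\<^sub>m mat k k (\<lambda>(i, j). 4 ^ (n + i + j) * (hop (1 / 2) ^^ (n + i + j)) (unit_at 0) 0)"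
    by (rule eq_matI) (use assms in \<open>auto simp: schroeder_matrix_def scaled_schroeder_moment\<close>)
  then have "rat_of_int (det (schroeder_matrix n k))
      = 2 ^ k * ((\<Prod>i<k. 4 ^ (n + 2 * i) * (1 / 2) ^ i) * ?A)"
    by (simp add: of_int_hom.hom_det[symmetric] hankel_determinant)
  also have "2 ^ k * ((\<Prod>i<k. 4 ^ (n + 2 * i) * (1 / 2) ^ i) * ?A)
      = (\<Prod>i<k. 2 * (4 ^ (n + 2 * i) * (1 / 2) ^ i)) * ?A"
    by (simp add: prod.distrib)
  also have "(\<Prod>i<k. 2 * (4 ^ (n + 2 * i) * (1 / 2) ^ i)) = (\<Prod>i<k. 2 ^ (1 + 2 * n + 3 * i) :: rat)"
  proof (rule prod.cong[OF refl])
    fix i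
    have "(4 :: rat) ^ (n + 2 * i) = 2 ^ (2 * n + 3 * i) * 2 ^ i"
    proof -
      have "(4 :: rat) ^ (n + 2 * i) = (2 ^ 2) ^ (n + 2 * i)" by simp
      also have "\<dots> = 2 ^ (2 * n + 3 * i) * 2 ^ i"
        by (simp only: power_mult[symmetric] power_add[symmetric]) (simp add: algebra_simps)
      finally show ?thesis .
    qed
    then show "2 * (4 ^ (n + 2 * i) * (1 / 2) ^ i) = (2 ^ (1 + 2 * n + 3 * i) :: rat)"
      by (simp add: power_one_over power_add)
  qed
  also have "\<dots> = 2 ^ (\<Sum>i<k. 1 + 2 * n + 3 * i)" by (rule power_sum[symmetric])
  finally have "rat_of_int (2 ^ (k choose 2) * det (schroeder_matrix n k))
      = 2 ^ ((k choose 2) + (\<Sum>i<k. 1 + 2 * n + 3 * i)) * ?A"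
    by (simp add: power_add)
  also have "\<dots> = rat_of_nat (num_pleasant (staircase (n + 2 * k)) (staircase n))"
    unfolding num_pleasant_staircase card_skew_staircase displacements_determinant[OF assms(1)] ..
  finally have "rat_of_int (2 ^ (k choose 2) * det (schroeder_matrix n k))
      = rat_of_int (int (num_pleasant (staircase (n + 2 * k)) (staircase n)))"
    by simp
  then show ?thesis by (simp only: of_int_eq_iff)
qed

end
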